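(* Let $\Omega\subseteq\mathbb{C}$ be a simply connected open set, let $\zeta_0\in\Omega$, and let $\mathcal{F}\subseteq\mathbb{N}\times\mathbb{N}$ be a set containing a sequence $(\tilde p_n,\tilde q_n)$, $n=1,2,\dots$, with $\tilde p_n\to+\infty$. Then there exists a function $f\in H(\Omega)$ with the following property: there exists a sequence $(p_n,q_n)\in\mathcal{F}$, $n=1,2,\dots$, such that $f\in\mathcal{D}_{p_n,q_n}(\zeta_0)$ for all $n$, and for every compact set $K\subseteq\Omega$ it holds that $\sup_{z\in K}\big|[p_n/q_n]_{f,\zeta_0}(z)-f(z)\big|\to 0$ as $n\to+\infty$. Furthermore, the set of all $f\in H(\Omega)$ with this property is a $G_\delta$ and dense subset of $H(\Omega)$.
   Context: An open set $\Omega\subseteq\mathbb{C}$ (not necessarily connected) is simply connected if $(\mathbb{C}\cup\{\infty\})\setminus\Omega$ is connected. $H(\Omega)$ is the space of holomorphic functions on $\Omega$ with the topology of uniform convergence on compact subsets of $\Omega$. Padé approximants. Degrees $p,q$ range over $\mathbb{N}=\{0,1,2,\dots\}$. Let $f=\sum_{v\ge 0}a_v(z-\zeta)^v$ be a power series centered at $\zeta\in\mathbb{C}$ (for $f$ holomorphic near $\zeta$, its Taylor series at $\zeta$). A Padé approximant $[p/q]_{f,\zeta}$ is a rational function of the form $P/Q$, $P(z)=\sum_{v=0}^p n_v(z-\zeta)^v$, $Q(z)=\sum_{v=0}^q d_v(z-\zeta)^v$ with $d_0=1$, whose Taylor coefficients $b_v$ at $\zeta$ satisfy $b_v=a_v$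 for $v=0,\dots,p+q$. We write $f\in\mathcal{D}_{p,q}(\zeta)$ if the Hankel determinant $\det\big(a_{p-q+i+j-1}\big)_{i,j=1}^q$ is nonzero, with $a_i=0$ for $i<0$ (for $q=0$ the condition is always satisfied). In that case $[p/q]_{f,\zeta}$ exists and is unique (for $q=0$ it is the Taylor partial sum $\sum_{v=0}^p a_v(z-\zeta)^v$). The value of a rational function at a pole is taken to be $\infty$, so a finite supremum over $K$ means that there are no poles in $K$. *)

theory Defs
  imports
    "HOL-Complex_Analysis.Complex_Analysis"
    "HOL-Library.Extended_Nonnegative_Real"
    "Jordan_Normal_Form.Determinant"
begin

text \<open>
  The Riemann sphere is the one-point compactification of the plane, with \<^term>\<open>None\<close>
  as the point at infinity.  This notion differs from the library's
  \<^const>\<open>simply_connected\<close>, which forces path-connectedness.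
\<close>

definition riemann_sphere :: "complex option topology" where
  "riemann_sphere = Alexandroff_compactification euclidean"

definition sphere_simply_connected :: "complex set \<Rightarrow> bool" where
  "sphere_simply_connected \<Omega> \<longleftrightarrow>
     connectedin riemann_sphere (topspace riemann_sphere - Some ` \<Omega>)"


text \<open>
  Elements of \<open>H(\<Omega>)\<close> are represented by total functions that are \<^const>\<open>undefined\<close>
  outside \<open>\<Omega>\<close>, so that equality of elements is equality on \<open>\<Omega>\<close>.
\<close>

definition holo_space :: "complex set \<Rightarrow> (complex \<Rightarrow> complex) set" where
  "holo_space \<Omega> = {f \<in> extensional \<Omega>. f holomorphic_on \<Omega>}"

definition holo_nbhd ::
  "complex set \<Rightarrow> complex set \<Rightarrow> real \<Rightarrow> (complex \<Rightarrow> complex) \<Rightarrow> (complex \<Rightarrow> complex) set" where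
  "holo_nbhd \<Omega> K e f = {g \<in> holo_space \<Omega>. \<forall>z\<in>K. dist (g z) (f z) < e}"

definition holo_topology :: "complex set \<Rightarrow> (complex \<Rightarrow> complex) topology" where
  "holo_topology \<Omega> = topology (\<lambda>U. U \<subseteq> holo_space \<Omega> \<and>
     (\<forall>f\<in>U. \<exists>K e. compact K \<and> K \<subseteq> \<Omega> \<and> e > 0 \<and> holo_nbhd \<Omega> K e f \<subseteq> U))"

lemma openin_holo_topology:
  "openin (holo_topology \<Omega>) U \<longleftrightarrow> U \<subseteq> holo_space \<Omega> \<and>
     (\<forall>f\<in>U. \<exists>K e. compact K \<and> K \<subseteq> \<Omega> \<and> e > 0 \<and> holo_nbhd \<Omega> K e f \<subseteq> U)"
proof -
  let ?L = "\<lambda>U. U \<subseteq> holo_space \<Omega> \<and>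
     (\<forall>f\<in>U. \<exists>K e. compact K \<and> K \<subseteq> \<Omega> \<and> e > 0 \<and> holo_nbhd \<Omega> K e f \<subseteq> U)"
  have int: "?L (S \<inter> T)" if S: "?L S" and T: "?L T" for S T
  proof (intro conjI ballI)
    show "S \<inter> T \<subseteq> holo_space \<Omega>" using S by blast
  next
    fix f assume f: "f \<in> S \<inter> T"
    from S f obtain K d where K: "compact K" "K \<subseteq> \<Omega>" "d > 0" "holo_nbhd \<Omega> K d f \<subseteq> S"
      by blast
    from T f obtain L e where L: "compact L" "L \<subseteq> \<Omega>" "e > 0" "holo_nbhd \<Omega> L e f \<subseteq> T"
      by blast
    have "holo_nbhd \<Omega> (K \<union> L) (min d e) f \<subseteq> holo_nbhd \<Omega> K d f \<inter> holo_nbhd \<Omega> L e f"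
      by (auto simp: holo_nbhd_def)
    then have "holo_nbhd \<Omega> (K \<union> L) (min d e) f \<subseteq> S \<inter> T"
      using K(4) L(4) by blast
    moreover have "compact (K \<union> L)" "K \<union> L \<subseteq> \<Omega>" "min d e > 0"
      using K L by auto
    ultimately show "\<exists>K e. compact K \<and> K \<subseteq> \<Omega> \<and> e > 0 \<and> holo_nbhd \<Omega> K e f \<subseteq> S \<inter> T"
      by blast
  qed
  have uni: "?L (\<Union>\<K>)" if *: "\<forall>S\<in>\<K>. ?L S" for \<K>
  proof (intro conjI ballI)
    show "\<Union>\<K> \<subseteq> holo_space \<Omega>" using * by blast
  next
    fix f assume "f \<in> \<Union>\<K>"
    then obtain S where S: "S \<in> \<K>" "f \<in> S" by blast
    with * obtain K e where "compact K" "K \<subseteq> \<Omega>" "e > 0" "holo_nbhd \<Omega> K e f \<subseteq> S" by meson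
    with S show "\<exists>K e. compact K \<and> K \<subseteq> \<Omega> \<and> e > 0 \<and> holo_nbhd \<Omega> K e f \<subseteq> \<Union>\<K>" by blast
  qed
  have "istopology ?L"
    unfolding istopology_def using int uni by blast
  then show ?thesis
    by (simp add: holo_topology_def topology_inverse')
qed

lemma topspace_holo_topology [simp]: "topspace (holo_topology \<Omega>) = holo_space \<Omega>"
proof -
  have "\<exists>K e. compact K \<and> K \<subseteq> \<Omega> \<and> e > 0 \<and> holo_nbhd \<Omega> K e f \<subseteq> holo_space \<Omega>" for f
    by (rule exI[of _ "{}"], rule exI[of _ "1::real"]) (auto simp: holo_nbhd_def)
  then have "openin (holo_topology \<Omega>) (holo_space \<Omega>)"
    by (auto simp: openin_holo_topology)
  then show ?thesis
    by (meson openin_holo_topology openin_subset openin_topspace subset_antisym)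
qed

lemma openin_holo_nbhd:
  assumes K: "compact K" "K \<subseteq> \<Omega>" and f: "f holomorphic_on \<Omega>"
  shows "openin (holo_topology \<Omega>) (holo_nbhd \<Omega> K e f)"
  unfolding openin_holo_topology
proof (intro conjI ballI)
  show "holo_nbhd \<Omega> K e f \<subseteq> holo_space \<Omega>" by (auto simp: holo_nbhd_def)
next
  fix g assume g: "g \<in> holo_nbhd \<Omega> K e f"
  have "\<exists>d>0. \<forall>z\<in>K. dist (g z) (f z) + d \<le> e"
  proof (cases "K = {}")
    case True
    then show ?thesis by (auto intro: exI[of _ 1])
  next
    case False
    have "g holomorphic_on \<Omega>" using g by (auto simp: holo_nbhd_def holo_space_def)
    then have "continuous_on K (\<lambda>z. dist (g z) (f z))"
      using f K(2) by (intro continuous_intros)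
        (auto intro: holomorphic_on_imp_continuous_on holomorphic_on_subset)
    then obtain x where x: "x \<in> K" "\<And>z. z \<in> K \<Longrightarrow> dist (g z) (f z) \<le> dist (g x) (f x)"
      using continuous_attains_sup[OF K(1) False] by blast
    have "dist (g x) (f x) < e" using g x(1) by (auto simp: holo_nbhd_def)
    then show ?thesis using x(2) by (intro exI[of _ "e - dist (g x) (f x)"]) auto
  qed
  then obtain d where d: "d > 0" "\<And>z. z \<in> K \<Longrightarrow> dist (g z) (f z) + d \<le> e" by blast
  have "holo_nbhd \<Omega> K d g \<subseteq> holo_nbhd \<Omega> K e f"
  proof
    fix h assume h: "h \<in> holo_nbhd \<Omega> K d g"
    have "dist (h z) (f z) < e" if z: "z \<in> K" for z
    proof -
      have "dist (h z) (g z) < d" using h z by (auto simp: holo_nbhd_def)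
      with d(2)[OF z] dist_triangle[of "h z" "f z" "g z"] show ?thesis by linarith
    qed
    with h show "h \<in> holo_nbhd \<Omega> K e f" by (auto simp: holo_nbhd_def)
  qed
  with K d(1) show "\<exists>L d. compact L \<and> L \<subseteq> \<Omega> \<and> d > 0 \<and> holo_nbhd \<Omega> L d g \<subseteq> holo_nbhd \<Omega> K e f"
    by blast
qed

lemma limitin_holo_topology:
  "limitin (holo_topology \<Omega>) F f net \<longleftrightarrow>
     f \<in> holo_space \<Omega> \<and> (\<forall>\<^sub>F n in net. F n \<in> holo_space \<Omega>) \<and>
     (\<forall>K. compact K \<and> K \<subseteq> \<Omega> \<longrightarrow> uniform_limit K F f net)"
proof (intro iffI conjI allI impI)
  assume L: "limitin (holo_topology \<Omega>) F f net"
  then show f: "f \<in> holo_space \<Omega>" by (simp add: limitin_def)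
  show "\<forall>\<^sub>F n in net. F n \<in> holo_space \<Omega>"
    using L f unfolding limitin_def
    by (metis openin_topspace topspace_holo_topology)
  fix K assume K: "compact K \<and> K \<subseteq> \<Omega>"
  show "uniform_limit K F f net"
    unfolding uniform_limit_iff
  proof (intro allI impI)
    fix e :: real assume "e > 0"
    then have "f \<in> holo_nbhd \<Omega> K e f" using f by (simp add: holo_nbhd_def)
    moreover have "openin (holo_topology \<Omega>) (holo_nbhd \<Omega> K e f)"
      using K f by (intro openin_holo_nbhd) (auto simp: holo_space_def)
    ultimately have "\<forall>\<^sub>F n in net. F n \<in> holo_nbhd \<Omega> K e f"
      using L by (simp add: limitin_def)
    then show "\<forall>\<^sub>F n in net. \<forall>z\<in>K. dist (F n z) (f z) < e"
      by (rule eventually_mono) (simp add: holo_nbhd_def)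
  qed
next
  assume R: "f \<in> holo_space \<Omega> \<and> (\<forall>\<^sub>F n in net. F n \<in> holo_space \<Omega>) \<and>
     (\<forall>K. compact K \<and> K \<subseteq> \<Omega> \<longrightarrow> uniform_limit K F f net)"
  show "limitin (holo_topology \<Omega>) F f net"
    unfolding limitin_def
  proof (intro conjI allI impI)
    show "f \<in> topspace (holo_topology \<Omega>)" using R by simp
  next
    fix U assume "openin (holo_topology \<Omega>) U \<and> f \<in> U"
    then obtain K e where K: "compact K" "K \<subseteq> \<Omega>" "e > 0" "holo_nbhd \<Omega> K e f \<subseteq> U"
      unfolding openin_holo_topology by blast
    have "\<forall>\<^sub>F n in net. \<forall>z\<in>K. dist (F n z) (f z) < e"
      using R K by (auto simp: uniform_limit_iff)
    moreover have "\<forall>\<^sub>F n in net. F n \<in> holo_space \<Omega>" using R by blast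
    ultimately show "\<forall>\<^sub>F n in net. F n \<in> U"
      by eventually_elim (use K(4) in \<open>auto simp: holo_nbhd_def\<close>)
  qed
qed


text \<open>
  A rational function is a map into the Riemann sphere, the value at a pole being
  \<^term>\<open>None\<close>.  The polynomials are in the variable \<open>z - \<zeta>\<close>.  The detour through
  \<^const>\<open>is_pole\<close> and \<^const>\<open>remove_sings\<close> makes the value depend only on the
  rational function, not on the fraction: common zeros of numerator and denominator
  are cancelled.
\<close>

definition ratfun :: "complex poly \<Rightarrow> complex poly \<Rightarrow> complex \<Rightarrow> complex \<Rightarrow> complex option" where
  "ratfun P Q \<zeta> z =
     (let R = (\<lambda>w. poly P (w - \<zeta>) / poly Q (w - \<zeta>))
      in if is_pole R z then None else Some (remove_sings R z))"

text \<open>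
  The power series \<open>\<Sum>v. a\<^sub>v (z - \<zeta>)\<^sup>v\<close> is represented by the formal power series \<open>a\<close>
  of its coefficients.
\<close>

definition is_pade_approximant ::
  "nat \<Rightarrow> nat \<Rightarrow> complex fps \<Rightarrow> complex \<Rightarrow> (complex \<Rightarrow> complex option) \<Rightarrow> bool" where
  "is_pade_approximant p q a \<zeta> R \<longleftrightarrow>
     (\<exists>P Q. degree P \<le> p \<and> degree Q \<le> q \<and> coeff Q 0 = 1 \<and>
        (\<forall>v \<le> p + q.
           fps_nth (fps_expansion (\<lambda>z. poly P (z - \<zeta>) / poly Q (z - \<zeta>)) \<zeta>) v = fps_nth a v) \<and>
        R = ratfun P Q \<zeta>)"

lemma ratfun_cong:
  assumes "Q1 \<noteq> 0" "Q2 \<noteq> 0" and eq: "P1 * Q2 = P2 * Q1"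
  shows "ratfun P1 Q1 \<zeta> = ratfun P2 Q2 \<zeta>"
proof
  fix z
  let ?R = "\<lambda>P Q w. poly P (w - \<zeta>) / poly Q (w - \<zeta>)"
  have "finite {x. poly (Q1 * Q2) x = 0}"
    using assms(1,2) by (intro poly_roots_finite) auto
  then have fin: "finite ((\<lambda>x. x + \<zeta>) ` {x. poly (Q1 * Q2) x = 0})" by blast
  then have "\<forall>\<^sub>F w in at z. w \<notin> (\<lambda>x. x + \<zeta>) ` {x. poly (Q1 * Q2) x = 0}"
    using islimpt_finite[OF fin, of z] unfolding islimpt_iff_eventually by simp
  then have ev: "\<forall>\<^sub>F w in at z. ?R P1 Q1 w = ?R P2 Q2 w"
  proof eventually_elim
    case (elim w)
    have "poly (Q1 * Q2) (w - \<zeta>) \<noteq> 0"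
    proof
      assume "poly (Q1 * Q2) (w - \<zeta>) = 0"
      then have "w - \<zeta> + \<zeta> \<in> (\<lambda>x. x + \<zeta>) ` {x. poly (Q1 * Q2) x = 0}" by blast
      with elim show False by simp
    qed
    moreover have "poly P1 (w - \<zeta>) * poly Q2 (w - \<zeta>) = poly P2 (w - \<zeta>) * poly Q1 (w - \<zeta>)"
      using eq by (metis poly_mult)
    ultimately show ?case by (simp add: frac_eq_eq)
  qed
  show "ratfun P1 Q1 \<zeta> z = ratfun P2 Q2 \<zeta> z"
    using is_pole_cong[OF ev refl] remove_sings_cong[OF ev refl] by (simp add: ratfun_def Let_def)
qed

lemma fps_expansion_quotient:
  assumes "coeff Q 0 = 1"
  shows "fps_expansion (\<lambda>z. poly P (z - \<zeta>) / poly Q (z - \<zeta>)) \<zeta> = fps_of_poly P / fps_of_poly Q"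
proof -
  have *: "poly R has_fps_expansion fps_of_poly R" for R :: "complex poly"
    by (simp add: has_fps_expansion_def)
  have "(\<lambda>x. poly P x / poly Q x) has_fps_expansion (fps_of_poly P / fps_of_poly Q)"
    using assms by (intro has_fps_expansion_divide' *) simp
  from fps_nth_fps_expansion[OF this] show ?thesis
    by (simp add: fps_eq_iff fps_expansion_def higher_deriv_shift_0[where z = \<zeta>] o_def)
qed

lemma is_pade_approximant_unique:
  assumes "is_pade_approximant p q a \<zeta> R1" "is_pade_approximant p q a \<zeta> R2"
  shows "R1 = R2"
proof -
  from assms(1) obtain P1 Q1 where 1: "degree P1 \<le> p" "degree Q1 \<le> q" "coeff Q1 0 = 1"
      "\<forall>v\<le>p+q. fps_nth (fps_of_poly P1 / fps_of_poly Q1) v = fps_nth a v" "R1 = ratfun P1 Q1 \<zeta>"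
    by (auto simp: is_pade_approximant_def fps_expansion_quotient)
  from assms(2) obtain P2 Q2 where 2: "degree P2 \<le> p" "degree Q2 \<le> q" "coeff Q2 0 = 1"
      "\<forall>v\<le>p+q. fps_nth (fps_of_poly P2 / fps_of_poly Q2) v = fps_nth a v" "R2 = ratfun P2 Q2 \<zeta>"
    by (auto simp: is_pade_approximant_def fps_expansion_quotient)
  define A where "A = fps_of_poly P1 / fps_of_poly Q1 - fps_of_poly P2 / fps_of_poly Q2"
  have A0: "fps_nth A v = 0" if "v \<le> p + q" for v
    using 1(4) 2(4) that by (simp add: A_def)
  have u: "is_unit (fps_of_poly Q1)" "is_unit (fps_of_poly Q2)"
    using 1(3) 2(3) by simp_all
  have B: "fps_of_poly P1 = fps_of_poly P1 / fps_of_poly Q1 * fps_of_poly Q1"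
          "fps_of_poly P2 = fps_of_poly P2 / fps_of_poly Q2 * fps_of_poly Q2"
    using u by simp_all
  have "b * c * d - e * d * c = (b - e) * (c * d)" for b c d e :: "complex fps"
    by (simp add: algebra_simps)
  then have D: "fps_of_poly (P1 * Q2 - P2 * Q1) = A * fps_of_poly (Q1 * Q2)"
    unfolding A_def fps_of_poly_diff fps_of_poly_mult using B by metis
  have "P1 * Q2 - P2 * Q1 = 0"
  proof (rule poly_eqI)
    fix n
    show "coeff (P1 * Q2 - P2 * Q1) n = coeff 0 n"
    proof (cases "n \<le> p + q")
      case True
      have "coeff (P1 * Q2 - P2 * Q1) n = fps_nth (A * fps_of_poly (Q1 * Q2)) n"
        by (metis D fps_of_poly_nth)
      also have "\<dots> = 0"
        using A0 True by (simp add: fps_mult_nth)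
      finally show ?thesis by simp
    next
      case False
      have "degree (P1 * Q2) \<le> p + q" "degree (P2 * Q1) \<le> p + q"
        using 1(1,2) 2(1,2) degree_mult_le[of P1 Q2] degree_mult_le[of P2 Q1] by linarith+
      with False show ?thesis by (simp add: coeff_eq_0)
    qed
  qed
  then have "P1 * Q2 = P2 * Q1" by simp
  moreover have "Q1 \<noteq> 0" "Q2 \<noteq> 0" using 1(3) 2(3) by auto
  ultimately show ?thesis using ratfun_cong 1(5) 2(5) by blast
qed

text \<open>
  By \<open>is_pade_approximant_unique\<close>, the description operator only needs existence, which
  the Hankel condition below guarantees.
\<close>

definition pade :: "nat \<Rightarrow> nat \<Rightarrow> complex fps \<Rightarrow> complex \<Rightarrow> complex \<Rightarrow> complex option" where
  "pade p q a \<zeta> = (THE R. is_pade_approximant p q a \<zeta> R)"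

definition fps_nth_int :: "complex fps \<Rightarrow> int \<Rightarrow> complex" where
  "fps_nth_int a k = (if k < 0 then 0 else fps_nth a (nat k))"

text \<open>
  Matrix indices start at \<open>0\<close>, so \<open>a\<^bsub>p-q+i+j-1\<^esub>\<close> with \<open>1 \<le> i, j \<le> q\<close> becomes
  \<open>a\<^bsub>p-q+i+j+1\<^esub>\<close> with \<open>0 \<le> i, j < q\<close>.  The determinant of the empty matrix is \<open>1\<close>.
\<close>

definition hankel_matrix :: "nat \<Rightarrow> nat \<Rightarrow> complex fps \<Rightarrow> complex mat" where
  "hankel_matrix p q a =
     Matrix.mat q q (\<lambda>(i, j). fps_nth_int a (int p - int q + int i + int j + 1))"

definition pade_class :: "nat \<Rightarrow> nat \<Rightarrow> complex \<Rightarrow> (complex \<Rightarrow> complex) set" where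
  "pade_class p q \<zeta> = {f. Determinant.det (hankel_matrix p q (fps_expansion f \<zeta>)) \<noteq> 0}"

text \<open>
  Suprema are taken in the extended nonnegative reals, where the empty supremum is \<open>0\<close>.
\<close>

fun sphere_dist :: "complex option \<Rightarrow> complex \<Rightarrow> ennreal" where
  "sphere_dist None w = \<infinity>"
| "sphere_dist (Some u) w = ennreal (cmod (u - w))"

definition pade_approximable ::
  "complex set \<Rightarrow> complex \<Rightarrow> (nat \<times> nat) set \<Rightarrow> (complex \<Rightarrow> complex) \<Rightarrow> bool" where
  "pade_approximable \<Omega> \<zeta> F f \<longleftrightarrow>
     (\<exists>p q :: nat \<Rightarrow> nat.
        (\<forall>n. (p n, q n) \<in> F) \<and>
        (\<forall>n. f \<in> pade_class (p n) (q n) \<zeta>) \<and>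
        (\<forall>K. compact K \<and> K \<subseteq> \<Omega> \<longrightarrow>
           (\<lambda>n. SUP z\<in>K. sphere_dist (pade (p n) (q n) (fps_expansion f \<zeta>) \<zeta> z) (f z))
             \<longlonglongrightarrow> 0))"

end

theory Submission
  imports Defs
begin

text \<open>
  A polynomial \<open>R\<close> in \<open>z - \<zeta>\<close> of exact degree \<open>p\<close> has an anti-triangular Hankel matrix with its
  leading coefficient on the antidiagonal, so it belongs to \<open>D\<^sub>p\<^sub>,\<^sub>q(\<zeta>)\<close> for every \<open>q\<close>, and it is
  its own \<open>[p/q]\<close> Pade approximant.  Hence it has the desired property with a constant sequence
  of degrees, and no Baire argument is needed: by Runge's theorem polynomials are dense in
  \<open>H(\<Omega>)\<close>, and adding a small multiple of \<open>(z - \<zeta>)\<^sup>p\<close> makes the degree exactly \<open>p\<close>.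

  For the \<open>G\<^sub>\<delta>\<close> claim, exhaust \<open>\<Omega>\<close> by compact sets \<open>C\<^sub>n\<close>.  The set in question is the intersection
  over \<open>n\<close> of the unions over \<open>(p,q) \<in> F\<close> of the sets of all \<open>f \<in> D\<^sub>p\<^sub>,\<^sub>q(\<zeta>)\<close> with
  \<open>sup |[p/q]\<^sub>f - f| < 1/(n+1)\<close> on \<open>C\<^sub>n\<close>.  These are open: numerator and denominator depend
  continuously on finitely many Taylor coefficients, and they have no common zero when the Hankel
  determinant is nonzero, so a finite supremum keeps the denominator away from zero on \<open>C\<^sub>n\<close>.
\<close>

section \<open>Polynomial approximation\<close>

text \<open>The polynomials are in \<open>z\<close> itself, so this predicate does not depend on a
  centre; recentring at \<zeta> is left to \<open>poly_approximate_degree\<close>.\<close>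

definition poly_approximable :: "complex set \<Rightarrow> (complex \<Rightarrow> complex) \<Rightarrow> bool" where
  "poly_approximable K f \<longleftrightarrow> (\<forall>e>0. \<exists>p. \<forall>z\<in>K. dist (f z) (poly p z) < e)"

section \<open>Stability under limits, sums, products and geometric series\<close>

lemma poly_approximable_poly: "poly_approximable K (poly p)"
  unfolding poly_approximable_def by (metis dist_self)

lemma poly_approximable_cong:
  "poly_approximable K f \<Longrightarrow> (\<And>z. z \<in> K \<Longrightarrow> f z = g z) \<Longrightarrow> poly_approximable K g"
  unfolding poly_approximable_def by metis

lemma poly_approximable_subset:
  "poly_approximable K f \<Longrightarrow> L \<subseteq> K \<Longrightarrow> poly_approximable L f"
  unfolding poly_approximable_def by (meson subsetD)

lemma poly_approximable_limit:
  assumes "\<And>e. e > 0 \<Longrightarrow> \<exists>g. poly_approximable K g \<and> (\<forall>z\<in>K. dist (f z) (g z) < e)"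
  shows "poly_approximable K f"
  unfolding poly_approximable_def
proof (intro allI impI)
  fix e :: real assume "e > 0"
  then obtain g where g: "poly_approximable K g" "\<forall>z\<in>K. dist (f z) (g z) < e / 2"
    using assms[of "e / 2"] by auto
  obtain p where "\<forall>z\<in>K. dist (g z) (poly p z) < e / 2"
    using g(1) \<open>e > 0\<close> unfolding poly_approximable_def by (metis half_gt_zero)
  then have "\<forall>z\<in>K. dist (f z) (poly p z) < e"
    using g(2) by (metis dist_triangle_half_r dist_commute)
  then show "\<exists>p. \<forall>z\<in>K. dist (f z) (poly p z) < e" by blast
qed

lemma poly_approximable_uniform_limit:
  assumes "\<And>n. poly_approximable K (g n)" "uniform_limit K g f sequentially"
  shows "poly_approximable K f"
proof (rule poly_approximable_limit)
  fix e :: real assume "e > 0"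
  with assms(2) have "\<forall>\<^sub>F n in sequentially. \<forall>z\<in>K. dist (g n z) (f z) < e"
    by (simp add: uniform_limit_iff)
  then obtain n where "\<forall>z\<in>K. dist (g n z) (f z) < e"
    by (auto simp: eventually_sequentially)
  then show "\<exists>h. poly_approximable K h \<and> (\<forall>z\<in>K. dist (f z) (h z) < e)"
    using assms(1) by (intro exI[of _ "g n"]) (simp add: dist_commute)
qed

text \<open>Passing from the epsilon form to sequences makes the standard rules for sums and
  products of uniform limits applicable.\<close>

lemma poly_approximable_iff_uniform_limit:
  "poly_approximable K f \<longleftrightarrow> (\<exists>p. uniform_limit K (\<lambda>n. poly (p n)) f sequentially)"
proof
  assume f: "poly_approximable K f"
  have "\<exists>p. \<forall>z\<in>K. dist (poly p z) (f z) < inverse (real (Suc n))" for n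
    using f unfolding poly_approximable_def
    by (metis dist_commute inverse_positive_iff_positive of_nat_0_less_iff zero_less_Suc)
  then obtain p where p: "\<And>n. \<forall>z\<in>K. dist (poly (p n) z) (f z) < inverse (real (Suc n))"
    by metis
  have "uniform_limit K (\<lambda>n. poly (p n)) f sequentially"
    unfolding uniform_limit_iff
  proof (intro allI impI)
    fix e :: real assume "e > 0"
    then have "\<forall>\<^sub>F n in sequentially. inverse (real (Suc n)) < e"
      using LIMSEQ_inverse_real_of_nat by (rule order_tendstoD(2)[rotated])
    then show "\<forall>\<^sub>F n in sequentially. \<forall>z\<in>K. dist (poly (p n) z) (f z) < e"
    proof eventually_elim
      case (elim n)
      then show ?case using less_trans[OF bspec[OF p]] by blast
    qed
  qed
  then show "\<exists>p. uniform_limit K (\<lambda>n. poly (p n)) f sequentially" by blast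
next
  assume "\<exists>p. uniform_limit K (\<lambda>n. poly (p n)) f sequentially"
  then obtain p where p: "uniform_limit K (\<lambda>n. poly (p n)) f sequentially" by blast
  show "poly_approximable K f"
    by (rule poly_approximable_uniform_limit[OF poly_approximable_poly p])
qed

lemma bounded_poly_image:
  fixes p :: "complex poly"
  assumes "compact K" shows "bounded (poly p ` K)"
  by (intro compact_imp_bounded compact_continuous_image assms continuous_on_poly continuous_on_id)

lemma poly_approximable_add:
  assumes "poly_approximable K f" "poly_approximable K g"
  shows "poly_approximable K (\<lambda>z. f z + g z)"
proof -
  obtain p q where "uniform_limit K (\<lambda>n. poly (p n)) f sequentially"
      "uniform_limit K (\<lambda>n. poly (q n)) g sequentially"
    using assms unfolding poly_approximable_iff_uniform_limit by blast
  then have "uniform_limit K (\<lambda>n z. poly (p n) z + poly (q n) z) (\<lambda>z. f z + g z) sequentially"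
    by (rule uniform_limit_add)
  moreover have "(\<lambda>n. poly (p n + q n)) = (\<lambda>n z. poly (p n) z + poly (q n) z)"
    by (simp add: fun_eq_iff)
  ultimately have "uniform_limit K (\<lambda>n. poly (p n + q n)) (\<lambda>z. f z + g z) sequentially"
    by (simp only:)
  then show ?thesis
    unfolding poly_approximable_iff_uniform_limit by (rule exI[of _ "\<lambda>n. p n + q n"])
qed

text \<open>A polynomial within distance 1 is bounded on the compact set. The product rule for
  uniform limits needs this, since \<open>f\<close> is not assumed continuous.\<close>

lemma poly_approximable_bounded:
  assumes K: "compact K" and f: "poly_approximable K f"
  shows "bounded (f ` K)"
proof -
  obtain p where p: "\<forall>z\<in>K. dist (f z) (poly p z) < 1"
    using f[unfolded poly_approximable_def, rule_format, of 1] by auto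
  obtain B where B: "\<forall>z\<in>K. norm (poly p z) \<le> B"
    using bounded_poly_image[OF K, of p] by (auto simp: bounded_iff)
  have "norm (f z) \<le> B + 1" if "z \<in> K" for z
    using p B that norm_triangle_ineq2[of "f z" "poly p z"] by (fastforce simp: dist_norm)
  then show ?thesis by (auto simp: bounded_iff)
qed

lemma poly_approximable_mult:
  assumes K: "compact K" and "poly_approximable K f" "poly_approximable K g"
  shows "poly_approximable K (\<lambda>z. f z * g z)"
proof -
  obtain p q where "uniform_limit K (\<lambda>n. poly (p n)) f sequentially"
      "uniform_limit K (\<lambda>n. poly (q n)) g sequentially"
    using assms unfolding poly_approximable_iff_uniform_limit by blast
  then have "uniform_limit K (\<lambda>n z. poly (p n) z * poly (q n) z) (\<lambda>z. f z * g z) sequentially"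
    using poly_approximable_bounded[OF K] assms(2,3) by (intro uniform_lim_mult)
  moreover have "(\<lambda>n. poly (p n * q n)) = (\<lambda>n z. poly (p n) z * poly (q n) z)"
    by (simp add: fun_eq_iff)
  ultimately have "uniform_limit K (\<lambda>n. poly (p n * q n)) (\<lambda>z. f z * g z) sequentially"
    by (simp only:)
  then show ?thesis
    unfolding poly_approximable_iff_uniform_limit by (rule exI[of _ "\<lambda>n. p n * q n"])
qed

lemma poly_approximable_const: "poly_approximable K (\<lambda>z. c)"
  using poly_approximable_poly[of K "[:c:]"] by (rule poly_approximable_cong) simp

lemma poly_approximable_cmult:
  assumes "compact K" "poly_approximable K f"
  shows "poly_approximable K (\<lambda>z. c * f z)"
  using poly_approximable_mult[OF assms(1) poly_approximable_const assms(2)] .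

lemma poly_approximable_sum:
  assumes "\<And>i. i \<in> I \<Longrightarrow> poly_approximable K (f i)"
  shows "poly_approximable K (\<lambda>z. \<Sum>i\<in>I. f i z)"
  using assms
  by (induction I rule: infinite_finite_induct)
    (auto intro: poly_approximable_const poly_approximable_add)

lemma poly_approximable_power:
  assumes "compact K" "poly_approximable K f"
  shows "poly_approximable K (\<lambda>z. f z ^ n)"
  by (induction n) (auto intro: poly_approximable_const poly_approximable_mult assms)

text \<open>The partial sums of the geometric series are polynomials in \<open>g\<close>, and the
  bound 1/2 makes them converge uniformly by the M-test. This is the only form of division that pole
  pushing needs.\<close>

lemma poly_approximable_geometric:
  assumes K: "compact K" and g: "poly_approximable K g"
    and bound: "\<And>z. z \<in> K \<Longrightarrow> norm (g z) \<le> 1 / 2"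
  shows "poly_approximable K (\<lambda>z. 1 / (1 - g z))"
proof (rule poly_approximable_uniform_limit)
  show "poly_approximable K (\<lambda>z. \<Sum>i<n. g z ^ i)" for n
    by (intro poly_approximable_sum poly_approximable_power K g)
  show "uniform_limit K (\<lambda>n z. \<Sum>i<n. g z ^ i) (\<lambda>z. 1 / (1 - g z)) sequentially"
  proof (rule uniform_limit_cong'[THEN iffD1])
    show "uniform_limit K (\<lambda>n z. \<Sum>i<n. g z ^ i) (\<lambda>z. \<Sum>i. g z ^ i) sequentially"
    proof (rule Weierstrass_m_test)
      show "norm (g z ^ n) \<le> (1/2) ^ n" if "z \<in> K" for n z
        using bound[OF that] by (simp add: norm_power power_mono del: power_divide)
      show "summable (\<lambda>n. (1/2::real) ^ n)"
        by (rule summable_geometric) simp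
    qed
    show "(\<Sum>i. g z ^ i) = 1 / (1 - g z)" if "z \<in> K" for z
      using bound[OF that] by (intro suminf_geometric) simp
  qed auto
qed

section \<open>Approximation of Cauchy kernels and Cauchy integrals\<close>

text \<open>Pole pushing: the set of all good \<open>w\<close> is open and closed in the complement of \<open>K\<close> and
  contains every \<open>w\<close> of large enough modulus.\<close>
lemma poly_approximable_Cauchy_kernel:
  assumes K: "compact K" and conn: "connected (- K)" and w: "w \<notin> K"
  shows "poly_approximable K (\<lambda>z. 1 / (w - z))"
proof -
  define P where "P = (\<lambda>w. poly_approximable K (\<lambda>z. 1 / (w - z)))"
  obtain B where B: "B > 0" "\<And>z. z \<in> K \<Longrightarrow> norm z \<le> B"
    using compact_imp_bounded[OF K] by (auto simp: bounded_pos)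
  \<comment> \<open>The modulus \<open>2 * B\<close> gives |z / v| \<le> 1/2 on \<open>K\<close>, so
    1 / (v - z) is a geometric series in z / v.\<close>
  define v where "v = complex_of_real (2 * B)"
  have nv: "norm v = 2 * B" using B(1) by (simp add: v_def norm_mult)
  have v: "v \<in> - K" using B nv by force
  have "poly_approximable K (\<lambda>z. 1 / (1 - (1 / v) * z))"
  proof (rule poly_approximable_geometric[OF K])
    show "poly_approximable K (\<lambda>z. (1 / v) * z)"
      using poly_approximable_poly[of K "[:0, 1 / v:]"] by (rule poly_approximable_cong) simp
    show "norm ((1 / v) * z) \<le> 1 / 2" if "z \<in> K" for z
      using B(1) B(2)[OF that] nv by (simp add: norm_divide norm_mult field_simps)
  qed
  then have "poly_approximable K (\<lambda>z. (1 / v) * (1 / (1 - (1 / v) * z)))"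
    by (rule poly_approximable_cmult[OF K])
  then have "P v"
    unfolding P_def
  proof (rule poly_approximable_cong)
    fix z assume "z \<in> K"
    have "v \<noteq> 0" using nv B(1) by auto
    then show "(1 / v) * (1 / (1 - (1 / v) * z)) = 1 / (v - z)"
      by (simp add: field_simps)
  qed
  \<comment> \<open>Local constancy of \<open>P\<close> on the connected set \<open>- K\<close>
    carries it from \<open>v\<close> to \<open>w\<close>.\<close>
  moreover have "\<exists>T. openin (top_of_set (- K)) T \<and> a \<in> T \<and> (\<forall>x\<in>T. \<forall>y\<in>T. P x \<longrightarrow> P y)"
    if a: "a \<in> - K" for a
  proof -
    have "open (- K)" using K by (simp add: compact_imp_closed open_Compl)
    then obtain d where d: "d > 0" "ball a d \<subseteq> - K"
      using a by (meson open_contains_ball)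
    \<comment> \<open>Radius d/5 gives |x - z| \<ge> 4d/5 and |x - y| \<le> 2d/5 for z in
      \<open>K\<close>, hence ratio at most 1/2 in the expansion 1/(y - z) = 1/(x - z) * 1/(1 - (x -
      y)/(x - z)).\<close>
    have "P y" if x: "x \<in> ball a (d / 5)" and y: "y \<in> ball a (d / 5)" and Px: "P x" for x y
    proof -
      have far: "dist a z \<ge> d" if "z \<in> K" for z
        using d(2) that by (meson ComplD mem_ball not_le subsetD)
      have xz: "norm (x - z) \<ge> 4 * d / 5" if "z \<in> K" for z
      proof -
        have "dist a z \<le> dist a x + dist x z" by (rule dist_triangle)
        with far[OF that] x show ?thesis by (simp add: dist_norm)
      qed
      have yz: "y \<noteq> z" if "z \<in> K" for z
        using far[OF that] y d(1) by auto
      have xy: "norm (x - y) \<le> 2 * d / 5"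
      proof -
        have "dist x y \<le> dist a x + dist a y" by (rule dist_triangle3)
        with x y show ?thesis by (simp add: dist_norm)
      qed
      have "poly_approximable K (\<lambda>z. 1 / (1 - (x - y) * (1 / (x - z))))"
      proof (rule poly_approximable_geometric[OF K])
        show "poly_approximable K (\<lambda>z. (x - y) * (1 / (x - z)))"
          using Px unfolding P_def by (rule poly_approximable_cmult[OF K])
        show "norm ((x - y) * (1 / (x - z))) \<le> 1 / 2" if "z \<in> K" for z
        proof -
          have "norm (x - y) * 2 \<le> norm (x - z)" using xz[OF that] xy by linarith
          moreover have "norm (x - z) > 0" using xz[OF that] d(1) by linarith
          ultimately show ?thesis by (simp add: norm_mult norm_divide field_simps)
        qed
      qed
      then have "poly_approximable K (\<lambda>z. 1 / (x - z) * (1 / (1 - (x - y) * (1 / (x - z)))))"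
        using Px poly_approximable_mult[OF K] unfolding P_def by blast
      then show "P y"
        unfolding P_def
      proof (rule poly_approximable_cong)
        fix z assume z: "z \<in> K"
        have "x - z \<noteq> 0" using xz[OF z] d(1) by auto
        moreover have "y - z \<noteq> 0" using yz[OF z] by auto
        moreover have "1 - (x - y) * (1 / (x - z)) = (y - z) / (x - z)"
          using \<open>x - z \<noteq> 0\<close> by (simp add: divide_simps)
        ultimately show "1 / (x - z) * (1 / (1 - (x - y) * (1 / (x - z)))) = 1 / (y - z)"
          by simp
      qed
    qed
    moreover have "openin (top_of_set (- K)) (ball a (d / 5))"
    proof (rule open_subset)
      show "ball a (d / 5) \<subseteq> - K" using d by (force simp: subset_iff)
    qed simp
    moreover have "a \<in> ball a (d / 5)" using d(1) by simp
    ultimately show ?thesis by (intro exI[of _ "ball a (d / 5)"] conjI ballI impI)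
  qed
  moreover have "w \<in> - K" using w by simp
  ultimately have "P w"
    using connected_induction_simple[OF conn v] by metis
  then show ?thesis by (simp add: P_def)
qed

text \<open>Uniform continuity of the kernel on the compact set [0,1] \<times> K makes the Riemann
  sums converge uniformly in \<open>z\<close>, and each of them is a finite combination of
  approximable functions.\<close>

lemma poly_approximable_integral:
  fixes k :: "real \<Rightarrow> complex \<Rightarrow> complex"
  assumes K: "compact K"
    and cont: "continuous_on ({0..1} \<times> K) (\<lambda>(t, z). k t z)"
    and k: "\<And>t. t \<in> {0..1} \<Longrightarrow> poly_approximable K (k t)"
  shows "poly_approximable K (\<lambda>z. integral {0..1} (\<lambda>t. k t z))"
proof (rule poly_approximable_limit)
  fix e :: real assume e: "e > 0"
  have "uniformly_continuous_on ({0..1} \<times> K) (\<lambda>(t, z). k t z)"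
    using cont K by (intro compact_uniformly_continuous compact_Times) auto
  then obtain d where d: "d > 0" and
      d': "\<And>x x'. x \<in> {0..1} \<times> K \<Longrightarrow> x' \<in> {0..1} \<times> K \<Longrightarrow> dist x' x < d \<Longrightarrow>
        dist ((\<lambda>(t, z). k t z) x') ((\<lambda>(t, z). k t z) x) < e / 2"
    by (rule uniformly_continuous_onE[where \<epsilon> = "e / 2"]) (use e in auto)
  have near: "norm (k t z - k s z) \<le> e / 2"
    if "t \<in> {0..1}" "s \<in> {0..1}" "z \<in> K" "\<bar>t - s\<bar> < d" for t s z
    using d'[of "(s, z)" "(t, z)"] that by (simp add: dist_norm norm_prod_def dist_prod_def)
  obtain n where n: "n > 0" "inverse (real n) < d"
    using d ex_inverse_of_nat_less by blast
  have c: "continuous_on {0..1} (\<lambda>t. k t z)" if "z \<in> K" for z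
    using that by (intro continuous_on_compose2[OF cont, of _ "\<lambda>t. (t, z)", simplified]
      continuous_intros) auto
  define x where "x = (\<lambda>j. real j / real n)"
  have x01: "x j \<in> {0..1}" if "j \<le> n" for j
    using that n(1) by (simp add: x_def)
  have xSuc: "x (Suc j) = x j + inverse (real n)" for j
    by (simp add: x_def add_divide_distrib inverse_eq_divide)
  \<comment> \<open>Each subinterval contributes an error of at most e/2 times its length; for m = n
    the total is e/2, because \<open>x n\<close> is 1.\<close>
  have step: "norm (integral {0..x m} (\<lambda>t. k t z) - (\<Sum>j<m. inverse (of_nat n) * k (x j) z))
      \<le> e / 2 * x m" if z: "z \<in> K" and "m \<le> n" for z m
    using \<open>m \<le> n\<close>
  proof (induction m)
    case 0
    then show ?case by (simp add: x_def)
  next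
    case (Suc m)
    have sub: "{x m..x (Suc m)} \<subseteq> {0..1}"
      using x01[of m] x01[of "Suc m"] Suc.prems by auto
    have le: "x m \<le> x (Suc m)" using xSuc by simp
    have i: "(\<lambda>t. k t z) integrable_on {0..x (Suc m)}"
      using x01[of "Suc m"] Suc.prems
      by (intro integrable_continuous_interval continuous_on_subset[OF c[OF z]]) auto
    have c': "continuous_on {x m..x (Suc m)} (\<lambda>t. k t z)"
      by (rule continuous_on_subset[OF c[OF z] sub])
    have "integral {x m..x (Suc m)} (\<lambda>t. k t z - k (x m) z) =
        integral {x m..x (Suc m)} (\<lambda>t. k t z) - inverse (of_nat n) * k (x m) z"
      using c' le
      by (subst Henstock_Kurzweil_Integration.integral_diff)
        (auto simp: xSuc scaleR_conv_of_real intro!: integrable_continuous_interval)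
    moreover have "norm (integral {x m..x (Suc m)} (\<lambda>t. k t z - k (x m) z))
        \<le> e / 2 * (x (Suc m) - x m)"
    proof (rule integral_bound[OF le])
      show "continuous_on {x m..x (Suc m)} (\<lambda>t. k t z - k (x m) z)"
        using c' by (intro continuous_intros)
      fix t assume t: "t \<in> {x m..x (Suc m)}"
      with n(2) xSuc[of m] have "\<bar>t - x m\<bar> < d" by auto
      then show "norm (k t z - k (x m) z) \<le> e / 2"
        using near sub t z x01[of m] Suc.prems by auto
    qed
    moreover have "integral {0..x (Suc m)} (\<lambda>t. k t z) =
        integral {0..x m} (\<lambda>t. k t z) + integral {x m..x (Suc m)} (\<lambda>t. k t z)"
      using x01[of m] Suc.prems le i
      by (intro Henstock_Kurzweil_Integration.integral_combine[symmetric]) auto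
    ultimately have eq: "integral {0..x (Suc m)} (\<lambda>t. k t z) -
          (\<Sum>j<Suc m. inverse (of_nat n) * k (x j) z) =
        (integral {0..x m} (\<lambda>t. k t z) - (\<Sum>j<m. inverse (of_nat n) * k (x j) z)) +
        integral {x m..x (Suc m)} (\<lambda>t. k t z - k (x m) z)"
      and bd: "norm (integral {x m..x (Suc m)} (\<lambda>t. k t z - k (x m) z))
        \<le> e / 2 * (x (Suc m) - x m)"
      by simp_all
    have "norm (integral {0..x m} (\<lambda>t. k t z) - (\<Sum>j<m. inverse (of_nat n) * k (x j) z))
        \<le> e / 2 * x m"
      using Suc by simp
    with bd show ?case
      unfolding eq by (intro norm_triangle_le) (simp add: algebra_simps)
  qed
  show "\<exists>g. poly_approximable K g \<and>
      (\<forall>z\<in>K. dist (integral {0..1} (\<lambda>t. k t z)) (g z) < e)"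
  proof (intro exI conjI ballI)
    show "poly_approximable K (\<lambda>z. \<Sum>j<n. inverse (of_nat n) * k (x j) z)"
      using x01 k by (intro poly_approximable_sum poly_approximable_cmult K) simp
    fix z assume "z \<in> K"
    from step[OF this, of n] n(1) e
    show "dist (integral {0..1} (\<lambda>t. k t z)) (\<Sum>j<n. inverse (of_nat n) * k (x j) z) < e"
      by (simp add: x_def dist_norm)
  qed
qed

text \<open>Pulling Cauchy's formula on a circle back along a conformal chart avoids any
  computation of winding numbers.\<close>
lemma Cauchy_formula_chart:
  assumes \<psi>: "\<psi> holomorphic_on ball 0 1" "inj_on \<psi> (ball 0 1)"
    and f: "f holomorphic_on \<psi> ` ball 0 1" and \<rho>: "\<rho> < 1" and a: "cmod a < \<rho>"
  shows "((\<lambda>u. f (\<psi> u) * deriv \<psi> u / (\<psi> u - \<psi> a)) has_contour_integral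
    2 * of_real pi * \<i> * f (\<psi> a)) (circlepath 0 \<rho>)"
proof -
  have a1: "a \<in> ball 0 1" using a \<rho> by simp
  have \<rho>0: "\<rho> > 0" using a by (meson norm_ge_zero order_le_less_trans)
  \<comment> \<open>The difference quotient of \<psi> with its removable singularity filled in.
    Injectivity leaves it without zeros, so the integrand becomes a holomorphic function over u - a,
    and that function takes the value f(\<psi> a) at \<open>a\<close>.\<close>
  define g where "g = (\<lambda>u. if u = a then deriv \<psi> a else (\<psi> u - \<psi> a) / (u - a))"
  have g: "g holomorphic_on ball 0 1"
    unfolding g_def by (rule pole_lemma_open[OF \<psi>(1)]) simp
  have d0: "deriv \<psi> a \<noteq> 0"
    by (rule holomorphic_injective_imp_regular[OF \<psi>(1) _ \<psi>(2) a1]) simp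
  have g0: "g u \<noteq> 0" if "u \<in> ball 0 1" for u
    using that d0 \<psi>(2) a1 by (auto simp: g_def dest: inj_onD)
  have f\<psi>: "(\<lambda>u. f (\<psi> u)) holomorphic_on ball 0 1"
    using holomorphic_on_compose[OF \<psi>(1) f] by (simp add: o_def)
  have "(\<lambda>u. f (\<psi> u) * deriv \<psi> u / g u) holomorphic_on ball 0 1"
    using g0 by (intro holomorphic_intros f\<psi> g holomorphic_deriv \<psi>(1)) auto
  then have "(\<lambda>u. f (\<psi> u) * deriv \<psi> u / g u) holomorphic_on cball 0 \<rho>"
    by (rule holomorphic_on_subset) (use \<rho> in auto)
  from Cauchy_integral_circlepath_simple[OF this, of a] a
  have "((\<lambda>u. f (\<psi> u) * deriv \<psi> u / g u / (u - a)) has_contour_integral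
    2 * of_real pi * \<i> * (f (\<psi> a) * deriv \<psi> a / g a)) (circlepath 0 \<rho>)"
    by simp
  moreover have "f (\<psi> a) * deriv \<psi> a / g a = f (\<psi> a)"
    using d0 by (simp add: g_def)
  ultimately have "((\<lambda>u. f (\<psi> u) * deriv \<psi> u / g u / (u - a)) has_contour_integral
    2 * of_real pi * \<i> * f (\<psi> a)) (circlepath 0 \<rho>)"
    by simp
  then show ?thesis
  proof (rule has_contour_integral_eq)
    fix u assume "u \<in> path_image (circlepath 0 \<rho>)"
    then have "u \<noteq> a" using a \<rho>0 by (auto simp: path_image_circlepath)
    then show "f (\<psi> u) * deriv \<psi> u / g u / (u - a) = f (\<psi> u) * deriv \<psi> u / (\<psi> u - \<psi> a)"
      by (simp add: g_def)
  qed
qed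

text \<open>The denominator has no zero in the disc, so Cauchy's theorem applies. This gives the
  zero branch of the cut-off function in \<open>poly_approximable_on_chart\<close>.\<close>

lemma Cauchy_formula_chart_outside:
  assumes \<psi>: "\<psi> holomorphic_on ball 0 1" and f: "f holomorphic_on \<psi> ` ball 0 1"
    and \<rho>: "0 < \<rho>" "\<rho> < 1" and z: "z \<notin> \<psi> ` ball 0 1"
  shows "((\<lambda>u. f (\<psi> u) * deriv \<psi> u / (\<psi> u - z)) has_contour_integral 0) (circlepath 0 \<rho>)"
proof (rule Cauchy_theorem_disc_simple)
  have f\<psi>: "(\<lambda>u. f (\<psi> u)) holomorphic_on ball 0 1"
    using holomorphic_on_compose[OF \<psi> f] by (simp add: o_def)
  show "(\<lambda>u. f (\<psi> u) * deriv \<psi> u / (\<psi> u - z)) holomorphic_on ball 0 1"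
    using z by (intro holomorphic_intros f\<psi> holomorphic_deriv \<psi>) auto
qed (use \<rho> in \<open>auto simp: path_image_circlepath\<close>)

text \<open>The Cauchy integral over the image of the circle of radius \<rho> equals f inside the
  chart and 0 outside it, at all points of \<open>K\<close>. It is an integral of Cauchy kernels
  with poles off \<open>K\<close>, so pole pushing applies under the integral sign.\<close>

lemma poly_approximable_on_chart:
  assumes K: "compact K" "connected (- K)"
    and \<psi>: "\<psi> holomorphic_on ball 0 1" "inj_on \<psi> (ball 0 1)"
    and f: "f holomorphic_on \<psi> ` ball 0 1" and \<rho>: "0 < \<rho>" "\<rho> < 1"
    and sub: "K \<inter> \<psi> ` ball 0 1 \<subseteq> \<psi> ` ball 0 \<rho>"
  shows "poly_approximable K (\<lambda>z. if z \<in> \<psi> ` ball 0 1 then f z else 0)"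
proof -
  define c where "c = circlepath 0 \<rho>"
  define G where "G = (\<lambda>t. f (\<psi> (c t)) * deriv \<psi> (c t) * vector_derivative c (at t))"
  have f\<psi>: "(\<lambda>u. f (\<psi> u)) holomorphic_on ball 0 1"
    using holomorphic_on_compose[OF \<psi>(1) f] by (simp add: o_def)
  have cball: "c t \<in> sphere 0 \<rho>" "c t \<in> ball 0 1" if "t \<in> {0..1}" for t
  proof -
    have "c t \<in> path_image c" using that by (auto simp: path_image_def)
    then show "c t \<in> sphere 0 \<rho>" "c t \<in> ball 0 1"
      using \<rho> by (auto simp: c_def path_image_circlepath)
  qed
  \<comment> \<open>A point of the curve in \<open>K\<close> would also be the image of some point
    of modulus less than \<rho>, against injectivity of \<psi>.\<close>
  have off: "\<psi> (c t) \<notin> K" if t: "t \<in> {0..1}" for t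
  proof
    assume "\<psi> (c t) \<in> K"
    with cball[OF t] sub obtain v where v: "v \<in> ball 0 \<rho>" "\<psi> (c t) = \<psi> v" by blast
    moreover have "v \<in> ball 0 1" using v(1) \<rho> by simp
    ultimately have "c t = v" using \<psi>(2) cball[OF t] by (meson inj_onD)
    with v(1) cball(1)[OF t] show False by simp
  qed
  have contc: "continuous_on {0..1} c"
    unfolding c_def using path_circlepath path_def by blast
  have comp: "continuous_on {0..1} (\<lambda>t. h (c t))" if "h holomorphic_on ball 0 1" for h
    by (rule continuous_on_compose2[OF holomorphic_on_imp_continuous_on[OF that] contc])
      (use cball in auto)
  have cont\<psi>: "continuous_on {0..1} (\<lambda>t. \<psi> (c t))" by (rule comp[OF \<psi>(1)])
  have contG: "continuous_on {0..1} G"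
    unfolding G_def
    by (intro continuous_intros comp[of "\<lambda>u. f (\<psi> u)"] comp[of "deriv \<psi>"] f\<psi>
        holomorphic_deriv \<psi>(1))
      (auto simp: c_def vector_derivative_circlepath intro!: continuous_intros)
  have "poly_approximable K (\<lambda>z. integral {0..1} (\<lambda>t. G t * (1 / (\<psi> (c t) - z))))"
  proof (rule poly_approximable_integral[OF K(1)])
    show "poly_approximable K (\<lambda>z. G t * (1 / (\<psi> (c t) - z)))" if "t \<in> {0..1}" for t
      by (intro poly_approximable_cmult K poly_approximable_Cauchy_kernel off that)
    have 1: "continuous_on ({0..1} \<times> K) (\<lambda>x. G (fst x))"
      by (rule continuous_on_compose2[OF contG]) (auto intro: continuous_intros)
    have 2: "continuous_on ({0..1} \<times> K) (\<lambda>x. \<psi> (c (fst x)))"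
      by (rule continuous_on_compose2[OF cont\<psi>]) (auto intro: continuous_intros)
    show "continuous_on ({0..1} \<times> K) (\<lambda>(t, z). G t * (1 / (\<psi> (c t) - z)))"
      unfolding case_prod_unfold
      by (intro continuous_intros 1 2) (use off in force)
  qed
  then have "poly_approximable K (\<lambda>z. 1 / (2 * of_real pi * \<i>) *
      integral {0..1} (\<lambda>t. G t * (1 / (\<psi> (c t) - z))))"
    by (rule poly_approximable_cmult[OF K(1)])
  then show ?thesis
  proof (rule poly_approximable_cong)
    fix z assume z: "z \<in> K"
    have "integral {0..1} (\<lambda>t. G t * (1 / (\<psi> (c t) - z))) =
        contour_integral c (\<lambda>u. f (\<psi> u) * deriv \<psi> u / (\<psi> u - z))"
      by (simp add: contour_integral_integral G_def field_simps)
    also have "\<dots> = 2 * of_real pi * \<i> * (if z \<in> \<psi> ` ball 0 1 then f z else 0)"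
    proof (cases "z \<in> \<psi> ` ball 0 1")
      case True
      with z sub obtain a where "a \<in> ball 0 \<rho>" "z = \<psi> a" by blast
      with True show ?thesis
        using contour_integral_unique[OF Cauchy_formula_chart[OF \<psi> f \<rho>(2), of a]]
        by (simp add: c_def)
    next
      case False
      then show ?thesis
        using contour_integral_unique[OF Cauchy_formula_chart_outside[OF \<psi>(1) f \<rho>]]
        by (simp add: c_def)
    qed
    finally show "1 / (2 * of_real pi * \<i>) * integral {0..1} (\<lambda>t. G t * (1 / (\<psi> (c t) - z))) =
        (if z \<in> \<psi> ` ball 0 1 then f z else 0)"
      by simp
  qed
qed

text \<open>For a proper subset of the plane this is the inverse Riemann map. The plane itself is
  not biholomorphic to the disc, but covering \<open>L\<close> is all that is asked, and a large
  disc does that.\<close>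

lemma simply_connected_disc_chart:
  assumes C: "open C" "simply_connected C" "C \<noteq> {}" and L: "compact L" "L \<subseteq> C"
  obtains \<psi> \<rho> where "\<psi> holomorphic_on ball 0 1" "inj_on \<psi> (ball 0 1)" "\<psi> ` ball 0 1 \<subseteq> C"
    "0 < \<rho>" "\<rho> < 1" "L \<subseteq> \<psi> ` ball (0::complex) \<rho>"
proof (cases "C = UNIV")
  case True
  obtain B where B: "B > 0" "\<forall>z\<in>L. norm z \<le> B"
    using compact_imp_bounded[OF L(1)] by (auto simp: bounded_pos)
  \<comment> \<open>The half disc is scaled to radius \<open>2 * B\<close>, which strictly exceeds
    the bound \<open>B\<close> for \<open>L\<close>.\<close>
  define b where "b = complex_of_real (4 * B)"
  have b: "norm b = 4 * B" "b \<noteq> 0" using B(1) by (auto simp: b_def norm_mult)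
  show ?thesis
  proof (rule that[of "\<lambda>u. b * u" "1/2"])
    show "L \<subseteq> (\<lambda>u. b * u) ` ball 0 (1 / 2)"
    proof
      fix z assume "z \<in> L"
      then have "norm (z / b) < 1 / 2" using B b by (simp add: norm_divide field_simps) force
      then show "z \<in> (\<lambda>u. b * u) ` ball 0 (1 / 2)"
        using b(2) by (intro image_eqI[of _ _ "z / b"]) auto
    qed
  qed (use True b(2) in \<open>auto intro!: holomorphic_intros inj_onI\<close>)
next
  case False
  with C obtain \<phi> \<psi> where \<phi>: "\<phi> holomorphic_on C" and \<psi>: "\<psi> holomorphic_on ball 0 1"
    and C_to: "\<forall>z\<in>C. \<phi> z \<in> ball 0 1 \<and> \<psi> (\<phi> z) = z"
    and D_to: "\<forall>z\<in>ball 0 1. \<psi> z \<in> C \<and> \<phi> (\<psi> z) = z"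
    using simply_connected_eq_biholomorphic_to_disc[OF C(1)] by auto
  have inj: "inj_on \<psi> (ball 0 1)" using D_to by (metis inj_onI)
  have "compact (\<phi> ` L)"
    using \<phi> L by (meson compact_continuous_image holomorphic_on_imp_continuous_on
      holomorphic_on_subset)
  moreover have "\<phi> ` L \<subseteq> ball 0 1" using C_to L(2) by blast
  ultimately obtain r where r: "r < 1" "\<phi> ` L \<subseteq> cball 0 r"
  proof (cases "\<phi> ` L = {}")
    case False
    assume cp: "compact (\<phi> ` L)" and s: "\<phi> ` L \<subseteq> ball 0 1"
      and th: "\<And>r. r < 1 \<Longrightarrow> \<phi> ` L \<subseteq> cball 0 r \<Longrightarrow> thesis"
    obtain u where "u \<in> \<phi> ` L" "\<forall>v\<in>\<phi> ` L. norm v \<le> norm u"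
      using continuous_attains_sup[OF cp False, of norm] by (auto intro: continuous_intros)
    then show thesis using s by (intro th[of "norm u"]) auto
  next
    case True
    assume th: "\<And>r. r < 1 \<Longrightarrow> \<phi> ` L \<subseteq> cball 0 r \<Longrightarrow> thesis"
    show thesis by (rule th[of 0]) (use True in auto)
  qed
  \<comment> \<open>\<open>max r 0\<close> ensures positivity, since only r < 1 is known about
    \<open>r\<close>.\<close>
  define \<rho> where "\<rho> = (max r 0 + 1) / 2"
  have \<rho>: "0 < \<rho>" "\<rho> < 1" "r < \<rho>" using r(1) by (auto simp: \<rho>_def)
  show ?thesis
  proof (rule that[OF \<psi> inj _ \<rho>(1,2)])
    show "\<psi> ` ball 0 1 \<subseteq> C" using D_to by blast
    show "L \<subseteq> \<psi> ` ball 0 \<rho>"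
    proof
      fix z assume z: "z \<in> L"
      then have "\<phi> z \<in> ball 0 \<rho>" using r(2) \<rho>(3) by force
      moreover have "z = \<psi> (\<phi> z)" using C_to L(2) z by auto
      ultimately show "z \<in> \<psi> ` ball 0 \<rho>" by blast
    qed
  qed
qed

section \<open>Simply connected open sets and Runge's theorem\<close>

lemma compact_Un_inside:
  fixes K :: "'a::euclidean_space set"
  assumes "compact K"
  shows "compact (K \<union> inside K)"
proof -
  have "closed (K \<union> inside K)"
    unfolding union_with_inside using assms by (simp add: closed_Compl compact_imp_closed open_outside)
  moreover have "bounded (K \<union> inside K)"
    using assms by (simp add: bounded_inside compact_imp_bounded)
  ultimately show ?thesis by (simp add: compact_eq_bounded_closed)
qed

text \<open>A point of \<open>inside K\<close> missing from \<Omega> would be separated from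
  infinity: \<open>inside K\<close> and the complement of the compact set
  \<open>K \<union> inside K\<close>, with infinity added, are disjoint open sets covering the
  complement of \<Omega> in the sphere. After this, only the absence of holes is used.\<close>

lemma inside_subset_sphere_simply_connected:
  assumes ssc: "sphere_simply_connected \<Omega>" and K: "compact K" "K \<subseteq> \<Omega>"
  shows "inside K \<subseteq> \<Omega>"
proof (rule ccontr)
  assume "\<not> inside K \<subseteq> \<Omega>"
  then obtain z where z: "z \<in> inside K" "z \<notin> \<Omega>" by blast
  define T where "T = topspace riemann_sphere - Some ` \<Omega>"
  define E1 where "E1 = Some ` inside K"
  define E2 where "E2 = insert None (Some ` (- (K \<union> inside K)))"
  have "openin riemann_sphere E1"
    using K(1) by (simp add: riemann_sphere_def E1_def open_inside compact_imp_closed)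
  moreover have "openin riemann_sphere E2"
    unfolding riemann_sphere_def openin_Alexandroff_compactification E2_def
    using compact_Un_inside[OF K(1)] by (auto simp: Compl_eq_Diff_UNIV compact_imp_closed)
  moreover have "T \<subseteq> E1 \<union> E2"
  proof
    fix x assume x: "x \<in> T"
    then show "x \<in> E1 \<union> E2"
      using K(2) by (cases x) (auto simp: T_def E1_def E2_def)
  qed
  moreover have "E1 \<inter> E2 \<inter> T = {}" by (auto simp: E1_def E2_def)
  moreover have "E1 \<inter> T \<noteq> {}"
    using z by (auto simp: E1_def T_def riemann_sphere_def)
  moreover have "E2 \<inter> T \<noteq> {}"
    by (auto simp: E2_def T_def riemann_sphere_def)
  ultimately have "\<not> connectedin riemann_sphere T"
    unfolding connectedin by blast
  with ssc show False by (simp add: sphere_simply_connected_def T_def)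
qed

text \<open>A closed path in \<open>C\<close> together with its inside is a connected subset of
  \<Omega>, so it stays in \<open>C\<close>. Points off \<open>C\<close> therefore lie outside the
  path and have winding number 0. This yields the notion of simple connectedness that the Riemann
  map requires.\<close>

lemma simply_connected_component:
  assumes \<Omega>: "open \<Omega>" and ins: "\<And>K. compact K \<Longrightarrow> K \<subseteq> \<Omega> \<Longrightarrow> inside K \<subseteq> \<Omega>"
    and C: "C \<in> components (\<Omega> :: complex set)"
  shows "simply_connected C"
proof -
  have "winding_number g z = 0"
    if g: "path g" "path_image g \<subseteq> C" "pathfinish g = pathstart g" and z: "z \<notin> C" for g z
  proof -
    let ?K = "path_image g"
    have K: "compact ?K" "connected ?K" "?K \<subseteq> \<Omega>"
      using g C in_components_subset compact_path_image connected_path_image by blast+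
    have "connected (?K \<union> inside ?K)"
      using K by (intro connected_with_inside) (auto simp: compact_imp_closed)
    moreover have "?K \<union> inside ?K \<subseteq> \<Omega>" using K ins by blast
    moreover have "C \<inter> (?K \<union> inside ?K) \<noteq> {}" using g(2) path_image_nonempty[of g] by blast
    ultimately have "?K \<union> inside ?K \<subseteq> C" using components_maximal[OF C] by blast
    then have "z \<in> outside ?K" using z inside_Un_outside[of ?K] by blast
    then show ?thesis using winding_number_zero_in_outside g by blast
  qed
  moreover have "open C" "connected C"
    using \<Omega> C open_components in_components_connected by blast+
  ultimately show ?thesis by (simp add: simply_connected_eq_winding_number_zero)
qed

text \<open>Filling the holes of \<open>K\<close> gives a compact \<open>L\<close> in \<Omega> with
  connected complement. Finitely many components cover \<open>L\<close>, and on \<open>L\<close> the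
  function is the sum of its cut-offs to these components, each handled by one chart.\<close>

lemma Runge_polynomial:
  assumes \<Omega>: "open \<Omega>" and ins: "\<And>K. compact K \<Longrightarrow> K \<subseteq> \<Omega> \<Longrightarrow> inside K \<subseteq> \<Omega>"
    and f: "f holomorphic_on \<Omega>" and K: "compact K" "K \<subseteq> \<Omega>"
  shows "poly_approximable K f"
proof -
  define L where "L = K \<union> inside K"
  have L: "compact L" "L \<subseteq> \<Omega>" using compact_Un_inside ins K by (auto simp: L_def)
  have connL: "connected (- L)"
    unfolding L_def union_with_inside
    using K(1) by (simp add: connected_outside compact_imp_bounded)
  obtain T where T: "T \<subseteq> components \<Omega>" "finite T" "L \<subseteq> \<Union>T"
  proof (rule compactE[OF L(1)])
    show "L \<subseteq> \<Union>(components \<Omega>)" using L(2) by simp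
    show "open B" if "B \<in> components \<Omega>" for B using that \<Omega> open_components by blast
  qed
  have one: "C = D" if "C \<in> T" "D \<in> T" "z \<in> C" "z \<in> D" for C D z
    using components_eq[of C \<Omega> D] that T(1) by blast
  have "poly_approximable L (\<lambda>z. if z \<in> C then f z else 0)" if CT: "C \<in> T" for C
  proof -
    have C: "C \<in> components \<Omega>" using T(1) CT by blast
    \<comment> \<open>The other components of the finite cover are open and contain the rest of
      \<open>L\<close>, so this piece is closed in \<open>L\<close>.\<close>
    have "L \<inter> C = L - \<Union>(T - {C})" using T(3) one CT by blast
    moreover have "open (\<Union>(T - {C}))" using T(1) \<Omega> open_components by blast
    ultimately have LC: "compact (L \<inter> C)" using L(1) by (simp add: compact_diff)
    obtain \<psi> \<rho> where \<psi>: "\<psi> holomorphic_on ball 0 1" "inj_on \<psi> (ball 0 1)"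
        "\<psi> ` ball 0 1 \<subseteq> C" "0 < \<rho>" "\<rho> < 1" "L \<inter> C \<subseteq> \<psi> ` ball (0::complex) \<rho>"
    proof (rule simply_connected_disc_chart[OF _ _ _ LC])
      show "open C" using \<Omega> C open_components by blast
      show "simply_connected C" by (rule simply_connected_component[OF \<Omega> ins C])
      show "C \<noteq> {}" using C in_components_nonempty by blast
    qed auto
    have sub: "\<psi> ` ball 0 \<rho> \<subseteq> \<psi> ` ball 0 1" using \<psi>(5) by (intro image_mono) auto
    have "poly_approximable L (\<lambda>z. if z \<in> \<psi> ` ball 0 1 then f z else 0)"
    proof (rule poly_approximable_on_chart[OF L(1) connL \<psi>(1,2) _ \<psi>(4,5)])
      show "f holomorphic_on \<psi> ` ball 0 1"
        using f by (rule holomorphic_on_subset) (use \<psi>(3) C in_components_subset in blast)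
      show "L \<inter> \<psi> ` ball 0 1 \<subseteq> \<psi> ` ball 0 \<rho>" using \<psi>(3,6) by blast
    qed
    then show ?thesis
    proof (rule poly_approximable_cong)
      \<comment> \<open>The chart may cover only a part of \<open>C\<close>, but it contains all of
        \<open>L \<inter> C\<close>.\<close>
      fix z assume "z \<in> L"
      then have "z \<in> \<psi> ` ball 0 1 \<longleftrightarrow> z \<in> C" using \<psi>(3,6) sub by blast
      then show "(if z \<in> \<psi> ` ball 0 1 then f z else 0) = (if z \<in> C then f z else 0)" by simp
    qed
  qed
  then have "poly_approximable L (\<lambda>z. \<Sum>C\<in>T. if z \<in> C then f z else 0)"
    by (rule poly_approximable_sum)
  then have "poly_approximable L f"
  proof (rule poly_approximable_cong)
    fix z assume "z \<in> L"
    then obtain D where D: "D \<in> T" "z \<in> D" using T(3) by blast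
    then have "(\<Sum>C\<in>T. if z \<in> C then f z else 0) = (\<Sum>C\<in>T. if C = D then f z else 0)"
      using one by (intro sum.cong) auto
    then show "(\<Sum>C\<in>T. if z \<in> C then f z else 0) = f z" using D(1) T(2) by simp
  qed
  then show ?thesis by (rule poly_approximable_subset) (simp add: L_def)
qed

section \<open>Hankel systems and Pade approximants\<close>

lemma tendsto_det:
  fixes A :: "'b \<Rightarrow> complex mat"
  assumes A: "\<And>n. A n \<in> carrier_mat m m" and B: "B \<in> carrier_mat m m"
    and lim: "\<And>i j. i < m \<Longrightarrow> j < m \<Longrightarrow> ((\<lambda>n. A n $$ (i, j)) \<longlongrightarrow> B $$ (i, j)) net"
  shows "((\<lambda>n. Determinant.det (A n)) \<longlongrightarrow> Determinant.det B) net"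
  unfolding Determinant.det_def'[OF A] Determinant.det_def'[OF B]
  by (intro tendsto_intros lim) (auto dest: permutes_in_image)

lemma tendsto_adj_mat:
  fixes A :: "'b \<Rightarrow> complex mat"
  assumes A: "\<And>n. A n \<in> carrier_mat m m" and B: "B \<in> carrier_mat m m"
    and lim: "\<And>i j. i < m \<Longrightarrow> j < m \<Longrightarrow> ((\<lambda>n. A n $$ (i, j)) \<longlongrightarrow> B $$ (i, j)) net"
    and ij: "i < m" "j < m"
  shows "((\<lambda>n. adj_mat (A n) $$ (i, j)) \<longlongrightarrow> adj_mat B $$ (i, j)) net"
proof -
  have dims: "dim_row (A n) = m" "dim_col (A n) = m" "dim_row B = m" "dim_col B = m" for n
    using A[of n] B by auto
  have "((\<lambda>n. Determinant.det (mat_delete (A n) j i)) \<longlongrightarrow>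
      Determinant.det (mat_delete B j i)) net"
    by (rule tendsto_det[where m = "m - 1"])
      (use ij in \<open>auto simp: mat_delete_def dims intro!: lim\<close>)
  then have "((\<lambda>n. cofactor (A n) j i) \<longlongrightarrow> cofactor B j i) net"
    unfolding cofactor_def by (intro tendsto_intros)
  then show ?thesis using ij by (simp add: adj_mat_def dims)
qed

lemma hankel_matrix_carrier: "hankel_matrix p q a \<in> carrier_mat q q"
  by (simp add: hankel_matrix_def)

lemma hankel_matrix_index:
  "i < q \<Longrightarrow> j < q \<Longrightarrow>
    hankel_matrix p q a $$ (i, j) = fps_nth_int a (int p - int q + int i + int j + 1)"
  by (simp add: hankel_matrix_def)

lemma adj_mat_sum:
  fixes A :: "complex mat"
  assumes A: "A \<in> carrier_mat q q" and "i < q" "j < q"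
  shows "(\<Sum>k<q. A $$ (i, k) * adj_mat A $$ (k, j)) = (if i = j then Determinant.det A else 0)"
    and "(\<Sum>k<q. adj_mat A $$ (i, k) * A $$ (k, j)) = (if i = j then Determinant.det A else 0)"
proof -
  have c: "adj_mat A \<in> carrier_mat q q" using adj_mat(1)[OF A] .
  have "(A * adj_mat A) $$ (i, j) = (\<Sum>k<q. A $$ (i, k) * adj_mat A $$ (k, j))"
    using A c assms(2,3) by (simp add: scalar_prod_def lessThan_atLeast0)
  then show "(\<Sum>k<q. A $$ (i, k) * adj_mat A $$ (k, j)) =
      (if i = j then Determinant.det A else 0)"
    unfolding adj_mat(2)[OF A] using assms(2,3) by (cases "i = j") simp_all
  have "(adj_mat A * A) $$ (i, j) = (\<Sum>k<q. adj_mat A $$ (i, k) * A $$ (k, j))"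
    using A c assms(2,3) by (simp add: scalar_prod_def lessThan_atLeast0)
  then show "(\<Sum>k<q. adj_mat A $$ (i, k) * A $$ (k, j)) =
      (if i = j then Determinant.det A else 0)"
    unfolding adj_mat(3)[OF A] using assms(2,3) by (cases "i = j") simp_all
qed

section \<open>Solving the Pade equations by the adjugate\<close>

text \<open>Writing the denominator as \<open>1 + x\<^sub>q\<^sub>-\<^sub>1 X + \<dots> + x\<^sub>0 X\<^sup>q\<close>, the Pade conditions in the
  degrees \<open>p + 1, \<dots>, p + q\<close> are the linear system \<open>H x = b\<close> with the Hankel matrix \<open>H\<close> and
  \<open>b\<^sub>i = - a\<^sub>p\<^sub>+\<^sub>i\<^sub>+\<^sub>1\<close>.  Solving it with the adjugate makes continuity in \<open>a\<close> evident.\<close>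
definition pade_denom_coeff :: "nat \<Rightarrow> nat \<Rightarrow> complex fps \<Rightarrow> nat \<Rightarrow> complex" where
  "pade_denom_coeff p q a l =
     - (\<Sum>i<q. adj_mat (hankel_matrix p q a) $$ (l, i) * fps_nth a (p + i + 1)) /
        Determinant.det (hankel_matrix p q a)"

definition pade_denom :: "nat \<Rightarrow> nat \<Rightarrow> complex fps \<Rightarrow> complex poly" where
  "pade_denom p q a = 1 + (\<Sum>l<q. monom (pade_denom_coeff p q a l) (q - l))"

definition pade_numer :: "nat \<Rightarrow> nat \<Rightarrow> complex fps \<Rightarrow> complex poly" where
  "pade_numer p q a = (\<Sum>v\<le>p. monom (fps_nth (a * fps_of_poly (pade_denom p q a)) v) v)"

lemma coeff_pade_denom:
  "coeff (pade_denom p q a) k =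
    (if k = 0 then 1 else 0) + (\<Sum>l<q. if q - l = k then pade_denom_coeff p q a l else 0)"
  by (simp add: pade_denom_def coeff_sum)

lemma coeff_pade_denom_0 [simp]: "coeff (pade_denom p q a) 0 = 1"
  by (simp add: coeff_pade_denom)

lemma coeff_pade_denom_diff:
  assumes "m < q"
  shows "coeff (pade_denom p q a) (q - m) = pade_denom_coeff p q a m"
proof -
  have "(\<Sum>l<q. if q - l = q - m then pade_denom_coeff p q a l else 0) =
      (\<Sum>l<q. if l = m then pade_denom_coeff p q a l else 0)"
    using assms by (intro sum.cong) auto
  then show ?thesis using assms by (simp add: coeff_pade_denom)
qed

lemma degree_pade_denom: "degree (pade_denom p q a) \<le> q"
  unfolding pade_denom_def
  by (intro degree_add_le degree_sum_le) (auto intro: order_trans[OF degree_monom_le])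

lemma degree_pade_numer: "degree (pade_numer p q a) \<le> p"
  unfolding pade_numer_def
  by (intro degree_sum_le) (auto intro: order_trans[OF degree_monom_le])

lemma coeff_pade_numer:
  "coeff (pade_numer p q a) v = (if v \<le> p then fps_nth (a * fps_of_poly (pade_denom p q a)) v else 0)"
  by (simp add: pade_numer_def coeff_sum)

text \<open>The reversal l = q - i turns the convolution index p + k + 1 - i into the Hankel index p
  - q + k + l + 1. The term i = 0 is split off as the inhomogeneous part.\<close>

lemma fps_nth_mult_poly_hankel:
  assumes R: "degree R \<le> q" and k: "k < q"
  shows "fps_nth (a * fps_of_poly R) (p + k + 1) = coeff R 0 * fps_nth a (p + k + 1) +
    (\<Sum>l<q. hankel_matrix p q a $$ (k, l) * coeff R (q - l))"
proof -
  define n where "n = p + k + 1"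
  define g where "g = (\<lambda>i. coeff R i * fps_nth_int a (int n - int i))"
  have "fps_nth (a * fps_of_poly R) n = (\<Sum>i = 0..n. coeff R i * fps_nth a (n - i))"
    by (subst mult.commute) (simp add: fps_mult_nth)
  also have "\<dots> = (\<Sum>i = 0..n. g i)"
    by (intro sum.cong) (auto simp: g_def fps_nth_int_def nat_diff_distrib')
  \<comment> \<open>Terms with i > q vanish by the degree of \<open>R\<close>, those with i > n
    because \<open>fps_nth_int\<close> is 0 at negative indices; so the range becomes 0..q whichever
    of \<open>n\<close> and \<open>q\<close> is larger.\<close>
  also have "\<dots> = (\<Sum>i \<in> {0..n} \<inter> {0..q}. g i)"
    using R by (intro sum.mono_neutral_right) (auto simp: g_def coeff_eq_0)
  also have "\<dots> = (\<Sum>i = 0..q. g i)"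
    by (intro sum.mono_neutral_left) (auto simp: g_def fps_nth_int_def)
  also have "\<dots> = g 0 + (\<Sum>i = 1..q. g i)"
    by (simp add: sum.atLeast_Suc_atMost)
  also have "(\<Sum>i = 1..q. g i) = (\<Sum>l<q. hankel_matrix p q a $$ (k, l) * coeff R (q - l))"
    using k
    by (intro sum.reindex_bij_witness[where i = "\<lambda>l. q - l" and j = "\<lambda>i. q - i"])
      (auto simp: g_def n_def hankel_matrix_index of_nat_diff algebra_simps)
  finally show ?thesis by (simp add: n_def g_def fps_nth_int_def nat_add_distrib)
qed

lemma pade_denom_annihilates:
  assumes D: "Determinant.det (hankel_matrix p q a) \<noteq> 0" and k: "k < q"
  shows "fps_nth (a * fps_of_poly (pade_denom p q a)) (p + k + 1) = 0"
proof -
  let ?H = "hankel_matrix p q a"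
  let ?d = "Determinant.det ?H"
  have "(\<Sum>l<q. ?H $$ (k, l) * coeff (pade_denom p q a) (q - l)) =
      (\<Sum>l<q. \<Sum>i<q. - (?H $$ (k, l) * adj_mat ?H $$ (l, i) * fps_nth a (p + i + 1)) / ?d)"
    by (intro sum.cong)
      (auto simp: coeff_pade_denom_diff pade_denom_coeff_def sum_distrib_left sum_negf sum_divide_distrib mult.assoc)
  also have "\<dots> = (\<Sum>i<q. \<Sum>l<q. - (?H $$ (k, l) * adj_mat ?H $$ (l, i) * fps_nth a (p + i + 1)) / ?d)"
    by (rule sum.swap)
  also have "\<dots> = (\<Sum>i<q. - ((\<Sum>l<q. ?H $$ (k, l) * adj_mat ?H $$ (l, i)) * fps_nth a (p + i + 1)) / ?d)"
    by (simp add: sum_distrib_right sum_negf sum_divide_distrib)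
  also have "\<dots> = (\<Sum>i<q. if k = i then - fps_nth a (p + i + 1) else 0)"
    using D k adj_mat_sum(1)[OF hankel_matrix_carrier] by (intro sum.cong) auto
  also have "\<dots> = - fps_nth a (p + k + 1)" using k by simp
  finally show ?thesis
    using fps_nth_mult_poly_hankel[OF degree_pade_denom k, where p = p and a = a] by simp
qed

text \<open>Up to degree \<open>p\<close> the numerator is by definition the truncation of a Q; the
  next \<open>q\<close> degrees are the Hankel system.\<close>

lemma pade_residual:
  assumes D: "Determinant.det (hankel_matrix p q a) \<noteq> 0" and v: "v \<le> p + q"
  shows "fps_nth (fps_of_poly (pade_numer p q a) - a * fps_of_poly (pade_denom p q a)) v = 0"
proof (cases "v \<le> p")
  case False
  then have "v = p + (v - p - 1) + 1" "v - p - 1 < q" using v by auto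
  then have "fps_nth (a * fps_of_poly (pade_denom p q a)) v = 0"
    using pade_denom_annihilates[OF D] by metis
  with False show ?thesis by (simp add: coeff_pade_numer)
qed (simp add: coeff_pade_numer)

lemma fps_nth_mult_eq_0:
  fixes A B :: "'a::comm_semiring_0 fps"
  assumes "\<And>v. v \<le> n \<Longrightarrow> fps_nth A v = 0" "v \<le> n"
  shows "fps_nth (A * B) v = 0"
  using assms by (simp add: fps_mult_nth)

text \<open>The denominator has constant term 1 and is a unit among power series, so P / Q - a
  vanishes to the same order as P - a Q.\<close>

lemma is_pade_approximant_pade:
  assumes D: "Determinant.det (hankel_matrix p q a) \<noteq> 0"
  shows "is_pade_approximant p q a \<zeta> (ratfun (pade_numer p q a) (pade_denom p q a) \<zeta>)"
proof -
  let ?P = "fps_of_poly (pade_numer p q a)" and ?Q = "fps_of_poly (pade_denom p q a)"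
  have "fps_nth (?P / ?Q) v = fps_nth a v" if v: "v \<le> p + q" for v
  proof -
    have "?P / ?Q = ?P * inverse ?Q" by (simp add: fps_divide_unit)
    also have "\<dots> = a * (?Q * inverse ?Q) + (?P - a * ?Q) * inverse ?Q"
      by (simp add: algebra_simps)
    also have "?Q * inverse ?Q = 1" by (simp add: inverse_mult_eq_1')
    finally have "fps_nth (?P / ?Q) v = fps_nth a v + fps_nth ((?P - a * ?Q) * inverse ?Q) v"
      by simp
    then show ?thesis using fps_nth_mult_eq_0[OF pade_residual[OF D] v] by simp
  qed
  then show ?thesis
    unfolding is_pade_approximant_def
    by (intro exI[of _ "pade_numer p q a"] exI[of _ "pade_denom p q a"])
      (simp add: fps_expansion_quotient degree_pade_numer degree_pade_denom)
qed

lemma pade_eq_ratfun: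
  assumes "Determinant.det (hankel_matrix p q a) \<noteq> 0"
  shows "pade p q a \<zeta> = ratfun (pade_numer p q a) (pade_denom p q a) \<zeta>"
  unfolding pade_def
  using is_pade_approximant_pade[OF assms] by (blast intro: the_equality is_pade_approximant_unique)

text \<open>A common zero \<open>z\<close> would make \<open>X Q / (X - z)\<close> a second solution of the homogeneous
  Hankel system.\<close>
lemma pade_numer_denom_no_common_zero:
  assumes D: "Determinant.det (hankel_matrix p q a) \<noteq> 0" and z: "poly (pade_denom p q a) z = 0"
  shows "poly (pade_numer p q a) z \<noteq> 0"
proof
  assume "poly (pade_numer p q a) z = 0"
  let ?H = "hankel_matrix p q a"
  from \<open>poly (pade_numer p q a) z = 0\<close> z obtain P1 Q1
    where P1: "pade_numer p q a = [:- z, 1:] * P1" and Q1: "pade_denom p q a = [:- z, 1:] * Q1"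
    by (meson dvdE poly_eq_0_iff_dvd)
  \<comment> \<open>The constant term 1 of the denominator forces both factors to be nonzero at the
    origin.\<close>
  have "coeff (pade_denom p q a) 0 = - z * coeff Q1 0" unfolding Q1 by simp
  then have z0: "z \<noteq> 0" and Q10: "coeff Q1 0 \<noteq> 0" by auto
  have "Q1 \<noteq> 0" using Q10 by auto
  then have degQ1: "degree Q1 + 1 \<le> q"
    using degree_pade_denom[of p q a] unfolding Q1 by (subst (asm) degree_mult_eq) auto
  have P1v: "coeff P1 v = 0" if "p \<le> v" for v
  proof (cases "P1 = 0")
    case False
    then have "degree P1 + 1 \<le> p"
      using degree_pade_numer[of p q a] unfolding P1 by (subst (asm) degree_mult_eq) auto
    with that show ?thesis by (simp add: coeff_eq_0)
  qed simp
  define X where "X = fps_of_poly [:- z, 1:]"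
  define A where "A = fps_of_poly P1 - a * fps_of_poly Q1"
  have "fps_of_poly (pade_numer p q a) - a * fps_of_poly (pade_denom p q a) = X * A"
    unfolding P1 Q1 X_def A_def fps_of_poly_mult by (simp add: algebra_simps)
  then have XA: "fps_nth (X * A) v = 0" if "v \<le> p + q" for v
    using pade_residual[OF D that] by simp
  \<comment> \<open>As z is nonzero, X - z is a unit among power series, so cancelling it costs no
    order of vanishing.\<close>
  have "X * inverse X = 1" using z0 by (intro inverse_mult_eq_1') (simp add: X_def)
  then have AX: "A = X * A * inverse X" by (metis mult.commute mult.left_commute mult.right_neutral)
  then have A0: "fps_nth A v = 0" if "v \<le> p + q" for v
    by (subst AX) (rule fps_nth_mult_eq_0[OF XA that])
  \<comment> \<open>The constant term 0 makes the system homogeneous. The shift moves degree p + k +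
    1 down to p + k, where a Q1 agrees with P1, and P1 has no terms of degree \<open>p\<close> or
    more.\<close>
  define R where "R = pCons 0 Q1"
  have degR: "degree R \<le> q" using degQ1 \<open>Q1 \<noteq> 0\<close> by (simp add: R_def)
  have ker: "(\<Sum>l<q. ?H $$ (k, l) * coeff R (q - l)) = 0" if k: "k < q" for k
  proof -
    have aR: "a * fps_of_poly R = fps_X * (a * fps_of_poly Q1)"
      by (simp add: R_def fps_of_poly_pCons algebra_simps)
    have "fps_nth (a * fps_of_poly R) (p + k + 1) = fps_nth (a * fps_of_poly Q1) (p + k)"
      unfolding aR by simp
    also have "\<dots> = coeff P1 (p + k)" using A0[of "p + k"] k by (simp add: A_def)
    also have "\<dots> = 0" by (rule P1v) simp
    finally show ?thesis
      using fps_nth_mult_poly_hankel[OF degR k, of a p] by (simp add: R_def)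
  qed
  \<comment> \<open>The unknown with index q - 1 is the coefficient of X in \<open>R\<close>, that
    is Q1(0). Row \<open>m\<close> of the adjugate isolates it, multiplied by the
    determinant.\<close>
  define m where "m = q - 1"
  have m: "m < q" "q - m = 1" using degQ1 by (auto simp: m_def)
  have "0 = (\<Sum>k<q. adj_mat ?H $$ (m, k) * (\<Sum>l<q. ?H $$ (k, l) * coeff R (q - l)))"
    using ker by simp
  also have "\<dots> = (\<Sum>l<q. \<Sum>k<q. adj_mat ?H $$ (m, k) * ?H $$ (k, l) * coeff R (q - l))"
    by (subst sum.swap) (simp add: sum_distrib_left mult.assoc)
  also have "\<dots> = (\<Sum>l<q. (if m = l then Determinant.det ?H else 0) * coeff R (q - l))"
    using m(1) adj_mat_sum(2)[OF hankel_matrix_carrier]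
    by (intro sum.cong) (simp_all add: sum_distrib_right[symmetric])
  also have "\<dots> = (\<Sum>l<q. if l = m then Determinant.det ?H * coeff R (q - l) else 0)"
    by (intro sum.cong) auto
  also have "\<dots> = Determinant.det ?H * coeff Q1 0" using m by (simp add: R_def)
  finally show False using D Q10 by simp
qed

text \<open>Since \<open>ratfun\<close> cancels common zeros, the nonvanishing of the numerator is
  what makes the zero of \<open>Q\<close> a genuine pole.\<close>

lemma ratfun_at_pole:
  assumes Q: "Q \<noteq> 0" and zero: "poly Q (z - \<zeta>) = 0" and P: "poly P (z - \<zeta>) \<noteq> 0"
  shows "ratfun P Q \<zeta> z = None"
proof -
  have "finite ((\<lambda>x. x + \<zeta>) ` {x. poly Q x = 0})" using Q poly_roots_finite by blast
  then have "\<forall>\<^sub>F w in at z. w \<notin> (\<lambda>x. x + \<zeta>) ` {x. poly Q x = 0}"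
    using islimpt_finite[of _ z] unfolding islimpt_iff_eventually by simp
  then have "\<forall>\<^sub>F w in at z. poly Q (w - \<zeta>) \<noteq> 0"
    by eventually_elim (force simp: image_iff)
  moreover have "((\<lambda>w. poly Q (w - \<zeta>)) \<longlongrightarrow> 0) (at z)"
    using zero by (auto intro!: tendsto_eq_intros)
  ultimately have "filterlim (\<lambda>w. poly Q (w - \<zeta>)) (at 0) (at z)"
    by (simp add: filterlim_at)
  moreover have "isCont (\<lambda>w. poly P (w - \<zeta>)) z" by (intro continuous_intros)
  ultimately have "is_pole (\<lambda>w. poly P (w - \<zeta>) / poly Q (w - \<zeta>)) z"
    using P by (intro is_pole_divide)
  then show ?thesis by (simp add: ratfun_def)
qed

lemma ratfun_regular:
  assumes "poly Q (z - \<zeta>) \<noteq> 0"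
  shows "ratfun P Q \<zeta> z = Some (poly P (z - \<zeta>) / poly Q (z - \<zeta>))"
proof -
  have "(\<lambda>w. poly P (w - \<zeta>) / poly Q (w - \<zeta>)) analytic_on {z}"
    unfolding poly_altdef[of P] poly_altdef[of Q]
    using assms by (intro analytic_intros) (auto simp: poly_altdef)
  then show ?thesis
    using analytic_at_imp_no_pole by (simp add: ratfun_def Let_def)
qed

section \<open>Continuous dependence of numerator and denominator on the Taylor coefficients\<close>

context
  fixes a :: "'b \<Rightarrow> complex fps" and b :: "complex fps" and net :: "'b filter"
  assumes lim: "\<And>k. ((\<lambda>n. fps_nth (a n) k) \<longlongrightarrow> fps_nth b k) net"
begin

lemma tendsto_hankel_matrix:
  assumes "i < q" "j < q"
  shows "((\<lambda>n. hankel_matrix p q (a n) $$ (i, j)) \<longlongrightarrow> hankel_matrix p q b $$ (i, j)) net"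
  using assms lim by (simp add: hankel_matrix_index fps_nth_int_def)

lemma tendsto_det_hankel_matrix:
  "((\<lambda>n. Determinant.det (hankel_matrix p q (a n))) \<longlongrightarrow>
    Determinant.det (hankel_matrix p q b)) net"
  by (intro tendsto_det[where m = q] hankel_matrix_carrier tendsto_hankel_matrix)

context
  fixes p q :: nat
  assumes D: "Determinant.det (hankel_matrix p q b) \<noteq> 0"
begin

text \<open>The quotient by the determinant converges as soon as the limit determinant is nonzero;
  nothing is required of the individual determinants along the net.\<close>

lemma tendsto_coeff_pade_denom:
  "((\<lambda>n. coeff (pade_denom p q (a n)) k) \<longlongrightarrow> coeff (pade_denom p q b) k) net"
proof -
  have "((\<lambda>n. pade_denom_coeff p q (a n) l) \<longlongrightarrow> pade_denom_coeff p q b l) net" if "l < q" for l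
    unfolding pade_denom_coeff_def using that D
    by (intro tendsto_intros lim tendsto_det_hankel_matrix tendsto_adj_mat[where m = q]
        hankel_matrix_carrier tendsto_hankel_matrix) auto
  then have "((\<lambda>n. if q - l = k then pade_denom_coeff p q (a n) l else 0) \<longlongrightarrow>
      (if q - l = k then pade_denom_coeff p q b l else 0)) net" if "l < q" for l
    using that by simp
  then show ?thesis unfolding coeff_pade_denom by (intro tendsto_intros) auto
qed

lemma tendsto_coeff_pade_numer:
  "((\<lambda>n. coeff (pade_numer p q (a n)) k) \<longlongrightarrow> coeff (pade_numer p q b) k) net"
  unfolding coeff_pade_numer
  by (auto simp: fps_mult_nth intro!: tendsto_intros lim tendsto_coeff_pade_denom)

end
end

section \<open>Topology of the set of approximable functions\<close>

lemma uniform_limit_sum: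
  fixes f :: "'i \<Rightarrow> 'b \<Rightarrow> 'c \<Rightarrow> 'd::real_normed_vector"
  assumes "\<And>i. i \<in> I \<Longrightarrow> uniform_limit K (f i) (g i) net"
  shows "uniform_limit K (\<lambda>n z. \<Sum>i\<in>I. f i n z) (\<lambda>z. \<Sum>i\<in>I. g i z) net"
  using assms
  by (induction I rule: infinite_finite_induct) (auto intro: uniform_limit_add uniform_limit_const)

text \<open>The common degree bound reduces coefficientwise convergence to a finite sum of terms,
  each uniform because powers are bounded on \<open>K\<close>.\<close>

lemma uniform_limit_poly:
  fixes R :: "'b \<Rightarrow> complex poly"
  assumes K: "bounded K" and deg: "\<And>n. degree (R n) \<le> N" "degree S \<le> N"
    and lim: "\<And>k. ((\<lambda>n. coeff (R n) k) \<longlongrightarrow> coeff S k) net"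
  shows "uniform_limit K (\<lambda>n z. poly (R n) (z - \<zeta>)) (\<lambda>z. poly S (z - \<zeta>)) net"
proof -
  have poly_eq: "poly T x = (\<Sum>i\<le>N. coeff T i * x ^ i)" if "degree T \<le> N" for T :: "complex poly" and x
    unfolding poly_altdef using that by (intro sum.mono_neutral_left) (auto simp: coeff_eq_0)
  have "uniform_limit K (\<lambda>n z. coeff (R n) i * (z - \<zeta>) ^ i) (\<lambda>z. coeff S i * (z - \<zeta>) ^ i) net" for i
  proof (rule uniform_lim_mult)
    show "uniform_limit K (\<lambda>n z. coeff (R n) i) (\<lambda>z. coeff S i) net"
      unfolding uniform_limit_iff using lim[of i] by (auto simp: tendsto_iff elim: eventually_mono)
    show "uniform_limit K (\<lambda>n z. (z - \<zeta>) ^ i) (\<lambda>z. (z - \<zeta>) ^ i) net"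
      by (rule uniform_limit_const)
    obtain B where B: "\<forall>z\<in>K. norm z \<le> B" using K by (auto simp: bounded_iff)
    have "norm ((z - \<zeta>) ^ i) \<le> (B + norm \<zeta>) ^ i" if "z \<in> K" for z
      unfolding norm_power using B that
      by (intro power_mono order_trans[OF norm_triangle_ineq4] add_mono) auto
    then show "bounded ((\<lambda>z. (z - \<zeta>) ^ i) ` K)" by (auto simp: bounded_iff)
  qed (auto simp: image_constant_conv)
  then have "uniform_limit K (\<lambda>n z. \<Sum>i\<le>N. coeff (R n) i * (z - \<zeta>) ^ i)
      (\<lambda>z. \<Sum>i\<le>N. coeff S i * (z - \<zeta>) ^ i) net"
    by (intro uniform_limit_sum)
  then show ?thesis by (simp only: poly_eq[OF deg(1)] poly_eq[OF deg(2)])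
qed

text \<open>A compact exhaustion gives countable neighbourhood bases: if \<open>U\<close> is not a
  neighbourhood of f, choose g n off \<open>U\<close> within 1/(n+1) of f on the n-th compact set.
  Openness can then be checked by limits of Taylor coefficients.\<close>

lemma openin_holo_topology_sequentially:
  assumes \<Omega>: "open \<Omega>" and U: "U \<subseteq> holo_space \<Omega>"
    and seq: "\<And>f g. \<lbrakk>f \<in> U; \<And>n. g n \<in> holo_space \<Omega>;
      \<And>K. \<lbrakk>compact K; K \<subseteq> \<Omega>\<rbrakk> \<Longrightarrow> uniform_limit K g f sequentially\<rbrakk> \<Longrightarrow>
      \<exists>n :: nat. g n \<in> U"
  shows "openin (holo_topology \<Omega>) U"
proof (rule ccontr)
  assume "\<not> openin (holo_topology \<Omega>) U"
  with U have "\<exists>f\<in>U. \<forall>K\<subseteq>\<Omega>. compact K \<longrightarrow> (\<forall>e>0. \<not> holo_nbhd \<Omega> K e f \<subseteq> U)"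
    by (simp add: openin_holo_topology)
  then obtain f where f: "f \<in> U" and
      no: "\<And>K e. \<lbrakk>compact K; K \<subseteq> \<Omega>; e > 0\<rbrakk> \<Longrightarrow> \<not> holo_nbhd \<Omega> K e f \<subseteq> U"
    by metis
  obtain C where C: "\<And>n :: nat. compact (C n)" "\<And>n. C n \<subseteq> \<Omega>"
      "\<And>K. \<lbrakk>compact K; K \<subseteq> \<Omega>\<rbrakk> \<Longrightarrow> \<exists>N. \<forall>n\<ge>N. K \<subseteq> C n"
    by (rule open_Union_compact_subsets[OF \<Omega>]) blast
  have "\<exists>g. g \<in> holo_nbhd \<Omega> (C n) (inverse (real (Suc n))) f - U" for n
    using no[OF C(1,2), of "inverse (real (Suc n))" n] by auto
  then obtain g where g: "\<And>n. g n \<in> holo_nbhd \<Omega> (C n) (inverse (real (Suc n))) f - U"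
    by metis
  have "uniform_limit K g f sequentially" if K: "compact K" "K \<subseteq> \<Omega>" for K
    unfolding uniform_limit_iff
  proof (intro allI impI)
    fix e :: real assume "e > 0"
    then have "\<forall>\<^sub>F n in sequentially. inverse (real (Suc n)) < e"
      using LIMSEQ_inverse_real_of_nat by (rule order_tendstoD(2)[rotated])
    moreover obtain N where "\<forall>n\<ge>N. K \<subseteq> C n" using C(3)[OF K] by blast
    then have "\<forall>\<^sub>F n in sequentially. K \<subseteq> C n" by (auto simp: eventually_sequentially)
    ultimately show "\<forall>\<^sub>F n in sequentially. \<forall>z\<in>K. dist (g n z) (f z) < e"
    proof eventually_elim
      case (elim n)
      have "\<forall>z\<in>C n. dist (g n z) (f z) < inverse (real (Suc n))"
        using g[of n] by (simp add: holo_nbhd_def)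
      then show ?case using elim less_trans by blast
    qed
  qed
  moreover have "g n \<in> holo_space \<Omega>" "g n \<notin> U" for n
    using g[of n] by (auto simp: holo_nbhd_def)
  ultimately show False using seq[OF f, of g] by blast
qed

text \<open>Weierstrass' theorem: uniform convergence on a disc around \<zeta> passes to all
  derivatives at its centre.\<close>

lemma tendsto_fps_expansion:
  assumes \<Omega>: "open \<Omega>" "\<zeta> \<in> \<Omega>" and g: "\<And>n. g n \<in> holo_space \<Omega>"
    and lim: "\<And>K. \<lbrakk>compact K; K \<subseteq> \<Omega>\<rbrakk> \<Longrightarrow> uniform_limit K g f sequentially"
  shows "(\<lambda>n. fps_nth (fps_expansion (g n) \<zeta>) k) \<longlonglongrightarrow> fps_nth (fps_expansion f \<zeta>) k"
proof -
  obtain r where r: "r > 0" "cball \<zeta> r \<subseteq> \<Omega>" using \<Omega> by (meson open_contains_cball)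
  have "uniform_limit (ball \<zeta> r) g f sequentially"
    by (rule uniform_limit_on_subset[OF lim[of "cball \<zeta> r"]]) (use r in auto)
  moreover have "g n holomorphic_on ball \<zeta> r" for n
  proof (rule holomorphic_on_subset)
    show "g n holomorphic_on \<Omega>" using g[of n] by (simp add: holo_space_def)
    show "ball \<zeta> r \<subseteq> \<Omega>" using r(2) ball_subset_cball by blast
  qed
  ultimately have "(\<lambda>n. (deriv ^^ k) (g n) \<zeta>) \<longlonglongrightarrow> (deriv ^^ k) f \<zeta>"
    using r(1) by (intro higher_deriv_complex_uniform_limit[where A = "ball \<zeta> r"]) auto
  then show ?thesis unfolding fps_expansion_def by (auto intro!: tendsto_intros)
qed

text \<open>The strict finite bound both rules out poles on \<open>K\<close> and leaves the slack
  that makes the set open.\<close>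

definition pade_close ::
  "complex set \<Rightarrow> complex \<Rightarrow> nat \<Rightarrow> nat \<Rightarrow> complex set \<Rightarrow> real \<Rightarrow> (complex \<Rightarrow> complex) set" where
  "pade_close \<Omega> \<zeta> p q K s = {f \<in> holo_space \<Omega>. f \<in> pade_class p q \<zeta> \<and>
     (SUP z\<in>K. sphere_dist (pade p q (fps_expansion f \<zeta>) \<zeta> z) (f z)) < ennreal s}"

lemma openin_pade_close:
  assumes \<Omega>: "open \<Omega>" "\<zeta> \<in> \<Omega>" and K: "compact K" "K \<subseteq> \<Omega>"
  shows "openin (holo_topology \<Omega>) (pade_close \<Omega> \<zeta> p q K s)"
proof (rule openin_holo_topology_sequentially[OF \<Omega>(1)])
  show "pade_close \<Omega> \<zeta> p q K s \<subseteq> holo_space \<Omega>" by (auto simp: pade_close_def)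
  fix f g
  assume f: "f \<in> pade_close \<Omega> \<zeta> p q K s" and g: "\<And>n :: nat. g n \<in> holo_space \<Omega>"
    and ulim: "\<And>K. \<lbrakk>compact K; K \<subseteq> \<Omega>\<rbrakk> \<Longrightarrow> uniform_limit K g f sequentially"
  define b where "b = fps_expansion f \<zeta>"
  define a where "a = (\<lambda>n. fps_expansion (g n) \<zeta>)"
  define S where "S = (SUP z\<in>K. sphere_dist (pade p q b \<zeta> z) (f z))"
  let ?P = "\<lambda>a z. poly (pade_numer p q a) (z - \<zeta>)"
  let ?Q = "\<lambda>a z. poly (pade_denom p q a) (z - \<zeta>)"
  have D: "Determinant.det (hankel_matrix p q b) \<noteq> 0" and Ss: "S < ennreal s"
    using f by (auto simp: pade_close_def pade_class_def S_def b_def)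
  have lim: "(\<lambda>n. fps_nth (a n) k) \<longlonglongrightarrow> fps_nth b k" for k
    unfolding a_def b_def by (rule tendsto_fps_expansion[OF \<Omega> g ulim])
  have pade_val: "pade p q c \<zeta> z = Some (?P c z / ?Q c z)"
    if "Determinant.det (hankel_matrix p q c) \<noteq> 0" "?Q c z \<noteq> 0" for c z
    using that by (simp add: pade_eq_ratfun ratfun_regular)
  \<comment> \<open>A zero of the denominator in \<open>K\<close> would be a true pole, as numerator
    and denominator share no zero, and the supremum would be infinite.\<close>
  have Qb: "?Q b z \<noteq> 0" if z: "z \<in> K" for z
  proof
    assume zero: "?Q b z = 0"
    have "pade_denom p q b \<noteq> 0" by (metis coeff_0 coeff_pade_denom_0 zero_neq_one)
    then have "pade p q b \<zeta> z = None"
      using zero pade_numer_denom_no_common_zero[OF D zero]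
      by (simp add: pade_eq_ratfun[OF D] ratfun_at_pole)
    then have "\<infinity> \<le> S"
      using SUP_upper[OF z, of "\<lambda>z. sphere_dist (pade p q b \<zeta> z) (f z)"] by (simp add: S_def)
    also note Ss
    finally show False by simp
  qed
  obtain s' where s': "S = ennreal s'" "0 \<le> s'" "s' < s"
  proof (cases S rule: ennreal_cases)
    case (real r)
    then show thesis using Ss that[of r] by (simp add: ennreal_less_iff)
  next
    case top
    then show thesis using Ss by simp
  qed
  have err: "cmod (?P b z / ?Q b z - f z) \<le> s'" if z: "z \<in> K" for z
  proof -
    have "ennreal (cmod (?P b z / ?Q b z - f z)) \<le> S"
      using SUP_upper[OF z, of "\<lambda>z. sphere_dist (pade p q b \<zeta> z) (f z)"] Qb[OF z] D
      by (simp add: S_def pade_val)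
    then show ?thesis using s' by simp
  qed
  have contQ: "continuous_on K (?Q b)" "continuous_on K (?P b)" by (intro continuous_intros)+
  \<comment> \<open>This lower bound makes the quotients converge uniformly, and it keeps every
    denominator within distance \<open>d\<close> of the limit one free of zeros on
    \<open>K\<close>.\<close>
  have "\<exists>d>0. \<forall>z\<in>K. d \<le> cmod (?Q b z)"
  proof (cases "K = {}")
    case False
    obtain z where "z \<in> K" "\<forall>w\<in>K. cmod (?Q b z) \<le> cmod (?Q b w)"
      using continuous_attains_inf[OF K(1) False continuous_on_norm[OF contQ(1)]] by blast
    then show ?thesis using Qb by (intro exI[of _ "cmod (?Q b z)"]) auto
  qed (simp add: exI[of _ 1])
  then obtain d where d: "d > 0" "\<And>z. z \<in> K \<Longrightarrow> d \<le> cmod (?Q b z)" by blast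
  have limQ: "uniform_limit K (\<lambda>n. ?Q (a n)) (?Q b) sequentially"
    using compact_imp_bounded[OF K(1)] degree_pade_denom degree_pade_denom
      tendsto_coeff_pade_denom[OF lim D] by (rule uniform_limit_poly)
  have limP: "uniform_limit K (\<lambda>n. ?P (a n)) (?P b) sequentially"
    using compact_imp_bounded[OF K(1)] degree_pade_numer degree_pade_numer
      tendsto_coeff_pade_numer[OF lim D] by (rule uniform_limit_poly)
  have "uniform_limit K (\<lambda>n z. ?P (a n) z / ?Q (a n) z) (\<lambda>z. ?P b z / ?Q b z) sequentially"
    using compact_imp_bounded[OF compact_continuous_image[OF contQ(2) K(1)]] d
    by (intro uniform_lim_divide[OF limP limQ]) auto
  then have "uniform_limit K (\<lambda>n z. ?P (a n) z / ?Q (a n) z - g n z)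
      (\<lambda>z. ?P b z / ?Q b z - f z) sequentially"
    by (intro uniform_limit_minus ulim K)
  \<comment> \<open>Half of the slack keeps the errors at most (s + s')/2, so the supremum, too,
    remains strictly below \<open>s\<close>.\<close>
  then have "\<forall>\<^sub>F n in sequentially. \<forall>z\<in>K.
      dist (?P (a n) z / ?Q (a n) z - g n z) (?P b z / ?Q b z - f z) < (s - s') / 2"
    by (rule uniform_limitD) (use s'(3) in simp)
  moreover have "\<forall>\<^sub>F n in sequentially. \<forall>z\<in>K. dist (?Q (a n) z) (?Q b z) < d"
    using limQ d(1) by (simp add: uniform_limit_iff)
  moreover have "\<forall>\<^sub>F n in sequentially. Determinant.det (hankel_matrix p q (a n)) \<noteq> 0"
    using tendsto_imp_eventually_ne[OF tendsto_det_hankel_matrix[OF lim] D] .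
  ultimately have "\<forall>\<^sub>F n in sequentially. g n \<in> pade_close \<Omega> \<zeta> p q K s"
  proof eventually_elim
    case (elim n)
    have "sphere_dist (pade p q (a n) \<zeta> z) (g n z) \<le> ennreal ((s + s') / 2)" if z: "z \<in> K" for z
    proof -
      have "?Q (a n) z \<noteq> 0" using elim(2) d(2)[OF z] z by (force simp: dist_norm)
      then have "pade p q (a n) \<zeta> z = Some (?P (a n) z / ?Q (a n) z)"
        using elim(3) pade_val by blast
      moreover have "cmod (?P (a n) z / ?Q (a n) z - g n z) \<le> (s - s') / 2 + s'"
        using bspec[OF elim(1) z] err[OF z]
          norm_triangle_sub[of "?P (a n) z / ?Q (a n) z - g n z" "?P b z / ?Q b z - f z"]
        unfolding dist_norm by linarith
      ultimately show ?thesis by (simp add: field_simps ennreal_leI)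
    qed
    then have "(SUP z\<in>K. sphere_dist (pade p q (a n) \<zeta> z) (g n z)) \<le> ennreal ((s + s') / 2)"
      by (rule SUP_least)
    also have "\<dots> < ennreal s" using s' by (intro ennreal_lessI) auto
    finally show ?case using g elim(3) by (simp add: pade_close_def pade_class_def a_def)
  qed
  then show "\<exists>n. g n \<in> pade_close \<Omega> \<zeta> p q K s" by (auto simp: eventually_sequentially)
qed

section \<open>Polynomials as their own Pade approximants\<close>

lemma det_hankel_matrix_fps_of_poly:
  assumes deg: "degree R = p" and R: "R \<noteq> 0"
  shows "Determinant.det (hankel_matrix p q (fps_of_poly R)) \<noteq> 0"
proof
  let ?H = "hankel_matrix p q (fps_of_poly R)"
  assume "Determinant.det ?H = 0"
  then obtain v where v: "v \<in> carrier_vec q" "v \<noteq> 0\<^sub>v q" and Hv: "?H *\<^sub>v v = 0\<^sub>v q"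
    using det_0_iff_vec_prod_zero[OF hankel_matrix_carrier] by blast
  have "\<exists>j<q. vec_index v j \<noteq> 0"
  proof (rule ccontr)
    assume "\<not> (\<exists>j<q. vec_index v j \<noteq> 0)"
    then have "v = 0\<^sub>v q" using v(1) by (intro eq_vecI) auto
    with v(2) show False by contradiction
  qed
  then obtain m where m: "m < q" "vec_index v m \<noteq> 0" "\<And>j. j < m \<Longrightarrow> vec_index v j = 0"
    using exists_least_iff[of "\<lambda>j. j < q \<and> vec_index v j \<noteq> 0"] by (metis less_trans)
  \<comment> \<open>\<open>m\<close> is the first nonzero entry of the kernel vector. In row q - 1 -
    m the leading coefficient sits in column \<open>m\<close> and zeros follow, so the row product
    is a single nonzero term.\<close>
  define i where "i = q - 1 - m"
  have i: "i < q" using m(1) by (simp add: i_def)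
  have "0 = vec_index (?H *\<^sub>v v) i" using Hv i by simp
  also have "\<dots> = (\<Sum>j<q. ?H $$ (i, j) * vec_index v j)"
    using i v(1) carrier_matD[OF hankel_matrix_carrier[of p q "fps_of_poly R"]]
    by (simp add: scalar_prod_def lessThan_atLeast0)
  also have "\<dots> = (\<Sum>j<q. if j = m then lead_coeff R * vec_index v m else 0)"
  proof (intro sum.cong refl)
    fix j assume "j \<in> {..<q}"
    then have j: "j < q" by simp
    consider "j < m" | "j = m" | "j > m" by linarith
    then show "?H $$ (i, j) * vec_index v j = (if j = m then lead_coeff R * vec_index v m else 0)"
    proof cases
      case 2
      then have "int p - int q + int i + int j + 1 = int p" using m(1) by (simp add: i_def of_nat_diff)
      then have "?H $$ (i, j) = fps_nth_int (fps_of_poly R) (int p)"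
        using i j by (simp only: hankel_matrix_index)
      with 2 show ?thesis using deg by (simp add: fps_nth_int_def)
    next
      case 3
      then have gt: "int p - int q + int i + int j + 1 > int p" using m(1) by (simp add: i_def of_nat_diff)
      then have "nat (int p - int q + int i + int j + 1) > degree R" using deg by linarith
      with 3 gt show ?thesis using i j by (simp add: hankel_matrix_index fps_nth_int_def coeff_eq_0)
    qed (use m(3) in simp)
  qed
  also have "\<dots> = lead_coeff R * vec_index v m" using m(1) by simp
  finally show False using R m(2) by simp
qed

lemma fps_expansion_eq_fps_of_poly:
  assumes \<Omega>: "open \<Omega>" "\<zeta> \<in> \<Omega>" and f: "\<And>z. z \<in> \<Omega> \<Longrightarrow> f z = poly R (z - \<zeta>)"
  shows "fps_expansion f \<zeta> = fps_of_poly R"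
proof -
  have "\<forall>\<^sub>F z in nhds \<zeta>. f z = poly R (z - \<zeta>) / poly 1 (z - \<zeta>)"
    using eventually_nhds_in_open[OF \<Omega>] by eventually_elim (simp add: f)
  then have "fps_expansion f \<zeta> = fps_expansion (\<lambda>z. poly R (z - \<zeta>) / poly 1 (z - \<zeta>)) \<zeta>"
    unfolding fps_expansion_def by (intro arg_cong[where f = Abs_fps] ext) (simp add: higher_deriv_cong_ev)
  also have "\<dots> = fps_of_poly R" by (subst fps_expansion_quotient) auto
  finally show ?thesis .
qed

lemma pade_poly:
  assumes deg: "degree R = p" and R: "R \<noteq> 0"
  shows "pade p q (fps_of_poly R) \<zeta> z = Some (poly R (z - \<zeta>))"
proof -
  have "is_pade_approximant p q (fps_of_poly R) \<zeta> (ratfun R 1 \<zeta>)"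
    unfolding is_pade_approximant_def
    by (intro exI[of _ R] exI[of _ 1]) (simp add: deg fps_expansion_eq_fps_of_poly[of UNIV])
  then have "pade p q (fps_of_poly R) \<zeta> = ratfun R 1 \<zeta>"
    unfolding pade_def by (blast intro: the_equality is_pade_approximant_unique)
  then show ?thesis by (simp add: ratfun_regular)
qed

lemma pade_approximable_poly:
  assumes \<Omega>: "open \<Omega>" "\<zeta> \<in> \<Omega>" and f: "\<And>z. z \<in> \<Omega> \<Longrightarrow> f z = poly R (z - \<zeta>)"
    and R: "R \<noteq> 0" and F: "(degree R, q) \<in> F"
  shows "pade_approximable \<Omega> \<zeta> F f"
proof -
  have "(SUP z\<in>K. sphere_dist (pade (degree R) q (fps_of_poly R) \<zeta> z) (f z)) = 0"
    if "K \<subseteq> \<Omega>" for K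
  proof -
    have "(SUP z\<in>K. sphere_dist (pade (degree R) q (fps_of_poly R) \<zeta> z) (f z)) \<le> 0"
      using that f by (intro SUP_least) (auto simp: pade_poly[OF refl R])
    then show ?thesis by simp
  qed
  then show ?thesis
    unfolding pade_approximable_def
    using F det_hankel_matrix_fps_of_poly[OF refl R]
    by (intro exI[of _ "\<lambda>_. degree R"] exI[of _ "\<lambda>_. q"])
      (simp add: pade_class_def fps_expansion_eq_fps_of_poly[OF \<Omega> f])
qed

section \<open>The G-delta representation\<close>

lemma pade_approximable_eq_Inter:
  assumes C: "\<And>n. compact (C n)" "\<And>n. C n \<subseteq> \<Omega>"
    "\<And>K. \<lbrakk>compact K; K \<subseteq> \<Omega>\<rbrakk> \<Longrightarrow> \<exists>N. \<forall>n\<ge>N. K \<subseteq> C n"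
  shows "{f \<in> holo_space \<Omega>. pade_approximable \<Omega> \<zeta> F f} =
    (\<Inter>n::nat. \<Union>(p, q)\<in>F. pade_close \<Omega> \<zeta> p q (C n) (inverse (real (Suc n))))"
proof (intro Set.equalityI subsetI)
  fix f assume f: "f \<in> {f \<in> holo_space \<Omega>. pade_approximable \<Omega> \<zeta> F f}"
  then have "pade_approximable \<Omega> \<zeta> F f" by blast
  then obtain p q :: "nat \<Rightarrow> nat" where
      pq: "\<forall>n. (p n, q n) \<in> F" "\<forall>n. f \<in> pade_class (p n) (q n) \<zeta>"
    and lim: "\<forall>K. compact K \<and> K \<subseteq> \<Omega> \<longrightarrow>
      (\<lambda>n. SUP z\<in>K. sphere_dist (pade (p n) (q n) (fps_expansion f \<zeta>) \<zeta> z) (f z)) \<longlonglongrightarrow> 0"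
    unfolding pade_approximable_def by blast
  have "\<exists>m. f \<in> pade_close \<Omega> \<zeta> (p m) (q m) (C n) (inverse (real (Suc n)))" for n
  proof -
    have "\<forall>\<^sub>F m in sequentially. (SUP z\<in>C n. sphere_dist
        (pade (p m) (q m) (fps_expansion f \<zeta>) \<zeta> z) (f z)) < ennreal (inverse (real (Suc n)))"
      by (rule order_tendstoD(2)[OF lim[rule_format, OF conjI[OF C(1,2)]]]) simp
    then obtain m where "(SUP z\<in>C n. sphere_dist
        (pade (p m) (q m) (fps_expansion f \<zeta>) \<zeta> z) (f z)) < ennreal (inverse (real (Suc n)))"
      by (meson eventually_happens sequentially_bot)
    then show ?thesis using f pq(2) by (auto simp: pade_close_def)
  qed
  \<comment> \<open>The chosen indices need not increase with \<open>n\<close>: membership in the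
    intersection asks only for one suitable pair for each \<open>n\<close>.\<close>
  then obtain m where "\<And>n. f \<in> pade_close \<Omega> \<zeta> (p (m n)) (q (m n)) (C n) (inverse (real (Suc n)))"
    by metis
  then show "f \<in> (\<Inter>n. \<Union>(p, q)\<in>F. pade_close \<Omega> \<zeta> p q (C n) (inverse (real (Suc n))))"
    using pq(1) by (intro INT_I UN_I[of "(p (m n), q (m n))" for n]) auto
next
  fix f assume f: "f \<in> (\<Inter>n. \<Union>(p, q)\<in>F. pade_close \<Omega> \<zeta> p q (C n) (inverse (real (Suc n))))"
  have "\<exists>p q. (p, q) \<in> F \<and> f \<in> pade_close \<Omega> \<zeta> p q (C n) (inverse (real (Suc n)))" for n
    using INT_D[OF f UNIV_I, of n] by auto
  then obtain p q where pq: "\<And>n. (p n, q n) \<in> F"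
      "\<And>n. f \<in> pade_close \<Omega> \<zeta> (p n) (q n) (C n) (inverse (real (Suc n)))"
    by metis
  have lim: "(\<lambda>n. SUP z\<in>K. sphere_dist (pade (p n) (q n) (fps_expansion f \<zeta>) \<zeta> z) (f z)) \<longlonglongrightarrow> 0"
    if K: "compact K" "K \<subseteq> \<Omega>" for K
  proof (rule tendsto_sandwich[OF _ _ tendsto_const])
    \<comment> \<open>From \<open>N\<close> on, the supremum over \<open>K\<close> is dominated by
      that over \<open>C n\<close>, which is below 1/(n+1).\<close>
    obtain N where N: "\<And>n. n \<ge> N \<Longrightarrow> K \<subseteq> C n" using C(3)[OF K] by blast
    show "\<forall>\<^sub>F n in sequentially. (SUP z\<in>K. sphere_dist
        (pade (p n) (q n) (fps_expansion f \<zeta>) \<zeta> z) (f z)) \<le> ennreal (inverse (real (Suc n)))"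
      unfolding eventually_sequentially
    proof (intro exI[of _ N] allI impI)
      fix n assume "n \<ge> N"
      then have "(SUP z\<in>K. sphere_dist (pade (p n) (q n) (fps_expansion f \<zeta>) \<zeta> z) (f z)) \<le>
          (SUP z\<in>C n. sphere_dist (pade (p n) (q n) (fps_expansion f \<zeta>) \<zeta> z) (f z))"
        using N by (intro SUP_subset_mono) auto
      also have "\<dots> \<le> ennreal (inverse (real (Suc n)))"
        using pq(2)[of n] by (simp add: pade_close_def less_imp_le)
      finally show "(SUP z\<in>K. sphere_dist
        (pade (p n) (q n) (fps_expansion f \<zeta>) \<zeta> z) (f z)) \<le> ennreal (inverse (real (Suc n)))" .
    qed
    show "(\<lambda>n. ennreal (inverse (real (Suc n)))) \<longlonglongrightarrow> 0"
      using tendsto_ennrealI[OF LIMSEQ_inverse_real_of_nat] by simp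
  qed simp
  have mem: "f \<in> holo_space \<Omega>" "f \<in> pade_class (p n) (q n) \<zeta>" for n
    using pq(2)[of n] by (simp_all add: pade_close_def)
  have "pade_approximable \<Omega> \<zeta> F f"
    unfolding pade_approximable_def
    by (rule exI[of _ p], rule exI[of _ q]) (simp add: pq(1) mem(2) lim)
  with mem(1) show "f \<in> {f \<in> holo_space \<Omega>. pade_approximable \<Omega> \<zeta> F f}" by simp
qed

lemma gdelta_in_pade_approximable:
  assumes \<Omega>: "open \<Omega>" "\<zeta> \<in> \<Omega>"
  shows "gdelta_in (holo_topology \<Omega>) {f \<in> holo_space \<Omega>. pade_approximable \<Omega> \<zeta> F f}"
proof -
  obtain C where C: "\<And>n :: nat. compact (C n)" "\<And>n. C n \<subseteq> \<Omega>"
      "\<And>K. \<lbrakk>compact K; K \<subseteq> \<Omega>\<rbrakk> \<Longrightarrow> \<exists>N. \<forall>n\<ge>N. K \<subseteq> C n"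
    by (rule open_Union_compact_subsets[OF \<Omega>(1)]) blast
  have "gdelta_in (holo_topology \<Omega>)
      (\<Inter>n. \<Union>(p, q)\<in>F. pade_close \<Omega> \<zeta> p q (C n) (inverse (real (Suc n))))"
  proof (rule gdelta_in_Inter)
    fix S assume "S \<in> range (\<lambda>n. \<Union>(p, q)\<in>F. pade_close \<Omega> \<zeta> p q (C n) (inverse (real (Suc n))))"
    then show "gdelta_in (holo_topology \<Omega>) S"
      by (auto intro!: open_imp_gdelta_in openin_Union openin_pade_close \<Omega> C)
  qed auto
  then show ?thesis by (simp only: pade_approximable_eq_Inter[where C = C, OF C])
qed

section \<open>Density and existence\<close>

lemma poly_approximate_degree:
  fixes p :: "complex poly"
  assumes K: "compact K" and e: "e > 0" and N: "degree p < N"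
  obtains R where "degree R = N" "R \<noteq> 0" "\<And>z. z \<in> K \<Longrightarrow> dist (poly R (z - \<zeta>)) (poly p z) < e"
proof -
  have "bounded ((\<lambda>z. (z - \<zeta>) ^ N) ` K)"
    by (intro compact_imp_bounded compact_continuous_image K continuous_intros)
  then obtain B where B: "B > 0" "\<And>z. z \<in> K \<Longrightarrow> cmod ((z - \<zeta>) ^ N) \<le> B"
    by (auto simp: bounded_pos)
  define d where "d = e / (2 * B)"
  have d: "d > 0" "d * B < e" using e B(1) by (auto simp: d_def)
  \<comment> \<open>Composition rewrites \<open>p\<close> in powers of z - \<zeta>. The added
    monomial exceeds its degree, which fixes the degree at \<open>N\<close>, and has modulus at most
    d B = e/2 on \<open>K\<close>.\<close>
  define R where "R = p \<circ>\<^sub>p [:\<zeta>, 1:] + monom (complex_of_real d) N"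
  have "degree (p \<circ>\<^sub>p [:\<zeta>, 1:]) < N" using N by (simp add: degree_pcompose)
  then have deg: "degree R = N"
    unfolding R_def using d(1) by (subst degree_add_eq_right) (auto simp: degree_monom_eq)
  have "dist (poly R (z - \<zeta>)) (poly p z) < e" if "z \<in> K" for z
  proof -
    have "dist (poly R (z - \<zeta>)) (poly p z) = d * cmod ((z - \<zeta>) ^ N)"
      using d(1) by (simp add: R_def poly_pcompose poly_monom dist_norm norm_mult)
    also have "\<dots> \<le> d * B" using B(2)[OF that] d(1) by (intro mult_left_mono) auto
    finally show ?thesis using d(2) by simp
  qed
  moreover have "R \<noteq> 0" using deg N by auto
  ultimately show ?thesis using that deg by blast
qed

text \<open>Half of \<open>e\<close> is spent on Runge approximation, half on raising the degree to
  some p with (p, q) in \<open>F\<close>. Unbounded first coordinates guarantee such a p above the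
  degree already reached.\<close>

lemma dense_pade_approximable:
  assumes \<Omega>: "open \<Omega>" "sphere_simply_connected \<Omega>" "\<zeta> \<in> \<Omega>"
    and F: "\<And>N. \<exists>(p, q)\<in>F. p > N"
  shows "holo_topology \<Omega> closure_of {f \<in> holo_space \<Omega>. pade_approximable \<Omega> \<zeta> F f} = holo_space \<Omega>"
proof (rule antisym)
  show "holo_topology \<Omega> closure_of {f \<in> holo_space \<Omega>. pade_approximable \<Omega> \<zeta> F f} \<subseteq> holo_space \<Omega>"
    using closure_of_subset_topspace by (metis topspace_holo_topology)
  show "holo_space \<Omega> \<subseteq> holo_topology \<Omega> closure_of {f \<in> holo_space \<Omega>. pade_approximable \<Omega> \<zeta> F f}"
  proof
    fix f assume f: "f \<in> holo_space \<Omega>"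
    have "\<exists>g\<in>{f \<in> holo_space \<Omega>. pade_approximable \<Omega> \<zeta> F f}. g \<in> T"
      if T: "f \<in> T" "openin (holo_topology \<Omega>) T" for T
    proof -
      obtain K e where K: "compact K" "K \<subseteq> \<Omega>" and e: "e > 0" and sub: "holo_nbhd \<Omega> K e f \<subseteq> T"
        using T unfolding openin_holo_topology by blast
      have "poly_approximable K f"
        using f by (intro Runge_polynomial[OF \<Omega>(1) inside_subset_sphere_simply_connected[OF \<Omega>(2)]] K)
          (auto simp: holo_space_def)
      then obtain P where P: "\<And>z. z \<in> K \<Longrightarrow> dist (f z) (poly P z) < e / 2"
        unfolding poly_approximable_def using e by (meson half_gt_zero)
      obtain p q where pq: "(p, q) \<in> F" "degree P < p" using F[of "degree P"] by auto
      obtain R where R: "degree R = p" "R \<noteq> 0"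
          "\<And>z. z \<in> K \<Longrightarrow> dist (poly R (z - \<zeta>)) (poly P z) < e / 2"
        using poly_approximate_degree[OF K(1) half_gt_zero[OF e] pq(2)] by blast
      \<comment> \<open>Restriction makes the polynomial extensional, as elements of
        \<open>holo_space \<Omega>\<close> must be.\<close>
      define g where "g = restrict (\<lambda>z. poly R (z - \<zeta>)) \<Omega>"
      have g: "g z = poly R (z - \<zeta>)" if "z \<in> \<Omega>" for z using that by (simp add: g_def)
      have "(\<lambda>z. poly R (z - \<zeta>)) holomorphic_on \<Omega>"
        unfolding poly_altdef by (intro holomorphic_intros)
      then have "g holomorphic_on \<Omega>" by (rule holomorphic_transform) (simp add: g)
      then have gH: "g \<in> holo_space \<Omega>" by (simp add: holo_space_def g_def)
      have "dist (g z) (f z) < e" if "z \<in> K" for z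
      proof -
        have "dist (g z) (poly P z) < e / 2" using R(3)[OF that] g K(2) that by auto
        with P[OF that] show ?thesis by (rule dist_triangle_half_l[rotated])
      qed
      then have "g \<in> T" using sub gH by (auto simp: holo_nbhd_def)
      moreover have "pade_approximable \<Omega> \<zeta> F g"
        using pade_approximable_poly[OF \<Omega>(1,3) g R(2)] pq(1) R(1) by blast
      ultimately show ?thesis using gH by blast
    qed
    then show "f \<in> holo_topology \<Omega> closure_of {f \<in> holo_space \<Omega>. pade_approximable \<Omega> \<zeta> F f}"
      using f by (simp add: in_closure_of)
  qed
qed

theorem theorem3p6:
  fixes \<Omega> :: "complex set" and \<zeta>\<^sub>0 :: complex
    and F :: "(nat \<times> nat) set" and p' q' :: "nat \<Rightarrow> nat"
  assumes "open \<Omega>"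
    and "sphere_simply_connected \<Omega>"
    and "\<zeta>\<^sub>0 \<in> \<Omega>"
    and "\<forall>n. (p' n, q' n) \<in> F"
    and "filterlim p' at_top sequentially"
  shows "(\<exists>f\<in>holo_space \<Omega>. pade_approximable \<Omega> \<zeta>\<^sub>0 F f) \<and>
    gdelta_in (holo_topology \<Omega>) {f \<in> holo_space \<Omega>. pade_approximable \<Omega> \<zeta>\<^sub>0 F f} \<and>
    (holo_topology \<Omega>) closure_of {f \<in> holo_space \<Omega>. pade_approximable \<Omega> \<zeta>\<^sub>0 F f} = holo_space \<Omega>"
proof -
  have "\<exists>(p, q)\<in>F. p > N" for N
  proof -
    have "\<forall>\<^sub>F n in sequentially. p' n > N"
      using assms(5)[unfolded filterlim_at_top, rule_format, of "Suc N"] by (simp add: Suc_le_eq)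
    then obtain n where "p' n > N" by (meson eventually_happens sequentially_bot)
    then show ?thesis using assms(4) by (intro bexI[of _ "(p' n, q' n)"]) auto
  qed
  then have dense: "holo_topology \<Omega> closure_of {f \<in> holo_space \<Omega>. pade_approximable \<Omega> \<zeta>\<^sub>0 F f} =
      holo_space \<Omega>"
    using assms by (intro dense_pade_approximable) auto
  \<comment> \<open>Existence follows from density: H(\<Omega>) contains the zero function, whereas
    an empty set would have empty closure.\<close>
  have "restrict (\<lambda>_. 0) \<Omega> holomorphic_on \<Omega>"
    by (rule holomorphic_transform[OF holomorphic_on_const]) simp
  then have "holo_space \<Omega> \<noteq> {}" by (auto simp: holo_space_def intro!: exI[of _ "restrict (\<lambda>_. 0) \<Omega>"])
  then have "{f \<in> holo_space \<Omega>. pade_approximable \<Omega> \<zeta>\<^sub>0 F f} \<noteq> {}"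
    using dense by (metis closure_of_empty)
  then have "\<exists>f\<in>holo_space \<Omega>. pade_approximable \<Omega> \<zeta>\<^sub>0 F f" by blast
  then show ?thesis
    using dense gdelta_in_pade_approximable[OF assms(1,3)] by (intro conjI)
qed

end
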